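(* Let $\bar\sigma\in\Sigma$ be the true parameter. There exists a constant $c_\infty>0$ independent of $N$ such that for all $t\in[0,T]$ and $\theta\in(0,\infty)$ it holds $$\|\widehat{x}_\infty(t)-\widehat{x}_{\bar\sigma}(t)\|_{P_{\bar\sigma}(t)}\le c_\infty\max_{j\in\{1,\dots,N\}}\|\mathcal{S}_j-\mathcal{S}_{\bar\sigma}\|_1,$$ $$\|\widehat{x}_\theta(t)-\widehat{x}_{\bar\sigma}(t)\|_{P_{\bar\sigma}(t)}\le c_\infty\max_{j\in\{1,\dots,N\}}\|\mathcal{S}_j-\mathcal{S}_{\bar\sigma}\|_1.$$
   Context: Setting. Fix $T>0$, $n,m,r\in\mathbb{N}$, $B\in\mathbb{R}^{n\times m}$, $C\in\mathbb{R}^{r\times n}$, $x_0\in\mathbb{R}^n$ and a measured output $y\in L^2(0,T;\mathbb{R}^r)$. $\|\cdot\|$ is the Euclidean norm, and $\|x\|_M^2=x^\top M x$ for a symmetric positive definite matrix $M$. Let $\Sigma=\Sigma_A\times\Sigma_\Gamma\times\Sigma_R\times\Sigma_Q$ be a product of finite nonempty sets, $\Sigma=\{\sigma_1,\dots,\sigma_N\}$, $N=|\Sigma|$. To each $\sigma=(\sigma_A,\sigma_\Gamma,\sigma_R,\sigma_Q)$ are assigned matrices $A_\sigma\in\mathbb{R}^{n\times n}$ (depending on $\sigma_A$ only) and symmetric positive definite matrices $\Gamma_\sigma\in\mathbb{R}^{n\times n}$, $R_\sigma\in\mathbb{R}^{m\times m}$, $Q_\sigma\in\mathbb{R}^{r\times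 r}$ (depending only on $\sigma_\Gamma$, $\sigma_R$, $\sigma_Q$ respectively). Index $k$ means $\sigma=\sigma_k$. Write $\mathcal{S}_\sigma=(A_\sigma,\Gamma_\sigma,R_\sigma,Q_\sigma)$ and, for such tuples (and their componentwise differences), $\|(A,\Gamma,R,Q)\|_1=\|A\|_{\mathbb{R}^{n,n}}+\|\Gamma\|_{\mathbb{R}^{n,n}}+\|R\|_{\mathbb{R}^{m,m}}+\|Q\|_{\mathbb{R}^{r,r}}$, where the norms on the right are matrix norms on the indicated spaces. For each $\sigma\in\Sigma$, $\Pi_\sigma$ is the unique solution on $[0,T]$ of $\dot\Pi_\sigma = A_\sigma\Pi_\sigma+\Pi_\sigma A_\sigma^\top-\Pi_\sigma C^\top Q_\sigma^{-1}C\Pi_\sigma+BR_\sigma B^\top$, $\Pi_\sigma(0)=\Gamma_\sigma$ (symmetric positive definite for all $t$), $P_\sigma(t)=\Pi_\sigma(t)^{-1}$, and $\widehat{x}_\sigma\in H^1(0,T;\mathbb{R}^n)$ solves $\dot{\widehat{x}}_\sigma=A_\sigma\widehat{x}_\sigma+\Pi_\sigma C^\top Q_\sigma^{-1}(y-C\widehat{x}_\sigma)$, $\widehat{x}_\sigma(0)=x_0$. Set $r_k(t)=\int_0^t\|y(s)-C\widehat{x}_k(s)\|_{Q_k^{-1}}^2\,ds$ and $\mathcal{V}_k(t,x)=\|x-\widehat{x}_k(t)\|_{P_k(t)}^2+r_k(t)$. Estimators (each minimizer over $x\in\mathbb{R}^n$ exists and is unique): $\widehat{x}_\infty(t)$ minimizes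 $\max_{k=1,\dots,N}\mathcal{V}_k(t,x)$; for $\theta\in(0,\infty)$, $\widehat{x}_\theta(t)$ minimizes $\frac1\theta\ln\left(\frac1N\sum_{k=1}^Ne^{\theta\mathcal{V}_k(t,x)}\right)$. *)

theory Defs
  imports "HOL-Analysis.Analysis"
begin

definition spd :: "real^'n^'n \<Rightarrow> bool" where
  "spd M \<longleftrightarrow> transpose M = M \<and> (\<forall>x. x \<noteq> 0 \<longrightarrow> x \<bullet> (M *v x) > 0)"

definition wnorm_sq :: "real^'n^'n \<Rightarrow> real^'n \<Rightarrow> real" where
  "wnorm_sq M x = x \<bullet> (M *v x)"

definition wnorm :: "real^'n^'n \<Rightarrow> real^'n \<Rightarrow> real" where
  "wnorm M x = sqrt (wnorm_sq M x)"

text \<open>An arbitrary vector-space norm. Nonnegativity follows from the other axioms, and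
  submultiplicativity is not required of a norm on a matrix space.\<close>

definition is_norm :: "('v::real_vector \<Rightarrow> real) \<Rightarrow> bool" where
  "is_norm \<nu> \<longleftrightarrow>
     (\<forall>v. \<nu> v = 0 \<longleftrightarrow> v = 0) \<and>
     (\<forall>a v. \<nu> (a *\<^sub>R v) = \<bar>a\<bar> * \<nu> v) \<and>
     (\<forall>v w. \<nu> (v + w) \<le> \<nu> v + \<nu> w)"

definition L2_on :: "real \<Rightarrow> (real \<Rightarrow> 'v::euclidean_space) \<Rightarrow> bool" where
  "L2_on T f \<longleftrightarrow>
     set_borel_measurable lebesgue {0..T} f \<and>
     set_integrable lebesgue {0..T} (\<lambda>t. (norm (f t))\<^sup>2)"

text \<open>\<open>H1_deriv T x g\<close>: on \<open>[0,T]\<close>, \<open>x\<close> is the continuous representative of an element of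
  \<open>H\<^sup>1(0,T)\<close>, and \<open>g \<in> L\<^sup>2(0,T)\<close> is its weak derivative.\<close>

definition H1_deriv :: "real \<Rightarrow> (real \<Rightarrow> 'v::euclidean_space) \<Rightarrow> (real \<Rightarrow> 'v) \<Rightarrow> bool" where
  "H1_deriv T x g \<longleftrightarrow>
     L2_on T g \<and>
     (\<forall>t\<in>{0..T}. x t = x 0 + set_lebesgue_integral lebesgue {0..t} g)"

type_synonym ('n, 'm, 'r) system = "(real^'n^'n) \<times> (real^'n^'n) \<times> (real^'m^'m) \<times> (real^'r^'r)"

text \<open>The tuple \<open>(A\<^sub>\<sigma>, \<Gamma>\<^sub>\<sigma>, R\<^sub>\<sigma>, Q\<^sub>\<sigma>)\<close>; each entry depends on its own component of \<open>\<sigma>\<close> only.\<close>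

fun system_of ::
  "('a \<Rightarrow> real^'n^'n) \<Rightarrow> ('b \<Rightarrow> real^'n^'n) \<Rightarrow> ('c \<Rightarrow> real^'m^'m) \<Rightarrow> ('d \<Rightarrow> real^'r^'r) \<Rightarrow>
   'a \<times> 'b \<times> 'c \<times> 'd \<Rightarrow> ('n::finite, 'm::finite, 'r::finite) system" where
  "system_of A \<Gamma> R Q (a, g, p, q) = (A a, \<Gamma> g, R p, Q q)"

fun admissible :: "('n::finite, 'm::finite, 'r::finite) system \<Rightarrow> bool" where
  "admissible (A, \<Gamma>, R, Q) \<longleftrightarrow> spd \<Gamma> \<and> spd R \<and> spd Q"

fun norm1 ::
  "(real^'n^'n \<Rightarrow> real) \<Rightarrow> (real^'m^'m \<Rightarrow> real) \<Rightarrow> (real^'r^'r \<Rightarrow> real) \<Rightarrow>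
   ('n::finite, 'm::finite, 'r::finite) system \<Rightarrow> real" where
  "norm1 \<nu>n \<nu>m \<nu>r (A, \<Gamma>, R, Q) = \<nu>n A + \<nu>n \<Gamma> + \<nu>m R + \<nu>r Q"

fun riccati_solution ::
  "real \<Rightarrow> real^'m^'n \<Rightarrow> real^'n^'r \<Rightarrow> ('n::finite, 'm::finite, 'r::finite) system \<Rightarrow> (real \<Rightarrow> real^'n^'n) \<Rightarrow> bool" where
  "riccati_solution T B C (A, \<Gamma>, R, Q) \<Pi>f \<longleftrightarrow>
     \<Pi>f 0 = \<Gamma> \<and>
     (\<forall>t\<in>{0..T}.
        (\<Pi>f has_vector_derivative
          (A ** \<Pi>f t + \<Pi>f t ** transpose A
           - \<Pi>f t ** transpose C ** matrix_inv Q ** C ** \<Pi>f t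
           + B ** R ** transpose B)) (at t within {0..T}))"

fun observer_solution ::
  "real \<Rightarrow> real^'n^'r \<Rightarrow> (real \<Rightarrow> real^'r) \<Rightarrow> real^'n \<Rightarrow> ('n::finite, 'm::finite, 'r::finite) system \<Rightarrow>
   (real \<Rightarrow> real^'n^'n) \<Rightarrow> (real \<Rightarrow> real^'n) \<Rightarrow> bool" where
  "observer_solution T C y x0 (A, \<Gamma>, R, Q) \<Pi>f xh \<longleftrightarrow>
     xh 0 = x0 \<and>
     (\<exists>g. H1_deriv T xh g \<and>
        (AE t in lebesgue. t \<in> {0..T} \<longrightarrow>
           g t = A *v xh t + (\<Pi>f t ** transpose C ** matrix_inv Q) *v (y t - C *v xh t)))"

fun value_fun ::
  "real^'n^'r \<Rightarrow> (real \<Rightarrow> real^'r) \<Rightarrow> ('n::finite, 'm::finite, 'r::finite) system \<Rightarrow>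
   (real \<Rightarrow> real^'n^'n) \<Rightarrow> (real \<Rightarrow> real^'n) \<Rightarrow> real \<Rightarrow> real^'n \<Rightarrow> real" where
  "value_fun C y (A, \<Gamma>, R, Q) \<Pi>f xh t x =
     wnorm_sq (matrix_inv (\<Pi>f t)) (x - xh t) +
     set_lebesgue_integral lebesgue {0..t} (\<lambda>s. wnorm_sq (matrix_inv Q) (y s - C *v xh s))"

definition estimate_max :: "'k set \<Rightarrow> ('k \<Rightarrow> real \<Rightarrow> 'v \<Rightarrow> real) \<Rightarrow> real \<Rightarrow> 'v" where
  "estimate_max \<Sigma> V t = (ARG_MIN (\<lambda>x. Max ((\<lambda>k. V k t x) ` \<Sigma>)) x. True)"

definition estimate_exp :: "real \<Rightarrow> 'k set \<Rightarrow> ('k \<Rightarrow> real \<Rightarrow> 'v \<Rightarrow> real) \<Rightarrow> real \<Rightarrow> 'v" where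
  "estimate_exp \<theta> \<Sigma> V t =
     (ARG_MIN (\<lambda>x. 1 / \<theta> * ln (1 / real (card \<Sigma>) * (\<Sum>k\<in>\<Sigma>. exp (\<theta> * V k t x)))) x. True)"

end

theory Submission
  imports Defs
begin

text \<open>
  Why the theorem holds. Up to the additive constant \<open>r\<^sub>k(t)\<close>, each value function is a squared
  distance to \<open>x\<^sub>k(t)\<close> in a norm weighted by \<open>P\<^sub>k(t)\<close>. Both aggregates, the maximum and the
  log-mean-exp, strictly increase when all values increase, so a minimizer \<open>z\<close> cannot have
  \<open>V\<^sub>k(t,z) > V\<^sub>k(t,x)\<close> for all \<open>k\<close>, whatever \<open>x\<close> is. Taking for \<open>x\<close> the true estimate, some \<open>k\<close>
  satisfies \<open>V\<^sub>k(t,z) \<le> V\<^sub>k(t,x)\<close>. The constant \<open>r\<^sub>k(t)\<close> cancels in this comparison, and the triangle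
  inequality in the weighted norm bounds the distance from \<open>z\<close> to \<open>x\<close> by twice the distance from
  \<open>x\<^sub>k(t)\<close> to \<open>x\<close>, whichever \<open>k\<close> it is (\<open>estimate_max_le_some_value\<close>,
  \<open>estimate_exp_le_some_value\<close>, \<open>distance_from_value_comparison\<close>). This argument is blind to the
  number of parameters and to \<open>\<theta>\<close>, which is where the independence of \<open>N\<close> and \<open>\<theta>\<close> comes from.

  It remains to see that the observer state depends on the system in a Lipschitz way and that the
  weights are comparable, with constants that depend on the systems only through the compact
  class \<open>K\<close>.

  The Riccati solution stays between multiples of the identity (\<open>riccati_lower_bound\<close>,
  \<open>riccati_upper_bound\<close>): compared with a suitable exponential times the identity, it can only lose
  definiteness at a time where the difference has a kernel vector (\<open>spd_barrier\<close>). That vector is an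
  eigenvector of the solution, and there the Riccati equation forces the derivative to point
  back inside.

  On the bounded region so obtained, the Riccati right-hand side is Lipschitz in the solution and
  in the data, and Gronwall's inequality transfers this to the solutions (\<open>riccati_lipschitz\<close>).
  Hence the observer gain is Lipschitz in the data, and a second use of Gronwall, now for weak
  derivatives because the output is only square integrable, gives the claim for the observer
  states (\<open>observer_lipschitz\<close>). Compactness of \<open>K\<close> and positive definiteness of the matrices
  in it make all constants uniform, and norms on a finite-dimensional space being
  equivalent, the estimate in Frobenius norms implies the one in the given norms.
\<close>

section \<open>Matrices with the Frobenius norm\<close>

lemma norm_matrix_vector_mult_le:
  fixes A :: "real^'n^'m"
  shows "norm (A *v x) \<le> norm A * norm x"
proof -
  have "norm (A *v x) = L2_set (\<lambda>i. norm ((A *v x) $ i)) UNIV"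
    by (simp add: norm_vec_def)
  also have "\<dots> \<le> L2_set (\<lambda>i. norm (A $ i) * norm x) UNIV"
    by (intro L2_set_mono) (simp_all add: matrix_vector_mul_component Cauchy_Schwarz_ineq2)
  also have "\<dots> = norm A * norm x"
    by (simp add: norm_vec_def L2_set_left_distrib)
  finally show ?thesis .
qed

lemma norm_transpose:
  fixes A :: "real^'n^'m"
  shows "norm (transpose A) = norm A"
proof -
  have "(norm (transpose A))\<^sup>2 = (norm A)\<^sup>2"
    unfolding power2_norm_eq_inner inner_vec_def transpose_def
    by (simp, subst sum.swap, simp)
  then show ?thesis by (simp add: power2_eq_iff_nonneg)
qed

lemma norm_matrix_mult_le:
  fixes A :: "real^'n^'m" and B :: "real^'k^'n"
  shows "norm (A ** B) \<le> norm A * norm B"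
proof -
  have row: "(A ** B) $ i = transpose B *v (A $ i)" for i
    by (simp add: vec_eq_iff matrix_matrix_mult_def vector_matrix_mult_def)
  have "norm (A ** B) = L2_set (\<lambda>i. norm (transpose B *v (A $ i))) UNIV"
    by (simp add: norm_vec_def[of "A ** B"] row)
  also have "\<dots> \<le> L2_set (\<lambda>i. norm (A $ i) * norm B) UNIV"
    by (intro L2_set_mono)
      (metis mult.commute norm_matrix_vector_mult_le norm_transpose, rule norm_ge_zero)
  also have "\<dots> = norm A * norm B"
    by (simp add: norm_vec_def[of A] L2_set_left_distrib)
  finally show ?thesis .
qed

lemma bounded_bilinear_matrix_mult:
  "bounded_bilinear ((**) :: real^'n^'m \<Rightarrow> real^'k^'n \<Rightarrow> real^'k^'m)"
proof (unfold_locales, goal_cases)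
  case 5
  show ?case by (rule exI[of _ 1]) (simp add: norm_matrix_mult_le)
qed (simp_all add: matrix_add_ldistrib matrix_matrix_mult_def vec_eq_iff
    algebra_simps sum.distrib sum_distrib_left)

lemma bounded_bilinear_matrix_vector_mult:
  "bounded_bilinear ((*v) :: real^'n^'m \<Rightarrow> real^'n \<Rightarrow> real^'m)"
proof (unfold_locales, goal_cases)
  case 5
  show ?case by (rule exI[of _ 1]) (simp add: norm_matrix_vector_mult_le)
qed (simp_all add: algebra_simps matrix_vector_mult_def vec_eq_iff sum.distrib sum_distrib_left)

lemmas matrix_mult_diff_left = bounded_bilinear.diff_left[OF bounded_bilinear_matrix_mult]
lemmas matrix_mult_diff_right = bounded_bilinear.diff_right[OF bounded_bilinear_matrix_mult]
lemmas continuous_on_matrix_vector_mult =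
  bounded_bilinear.continuous_on[OF bounded_bilinear_matrix_vector_mult]

lemma bounded_linear_transpose: "bounded_linear (transpose :: real^'n^'m \<Rightarrow> real^'m^'n)"
proof (rule bounded_linear_intro[where K = 1])
  show "norm (transpose A) \<le> norm A * 1" for A :: "real^'n^'m" by (simp add: norm_transpose)
qed (simp_all add: transpose_def vec_eq_iff)

lemma transpose_diff: "transpose (A - B :: real^'n^'m) = transpose A - transpose B"
  and transpose_add: "transpose (A + B :: real^'n^'m) = transpose A + transpose B"
  by (simp_all add: transpose_def vec_eq_iff)

lemma norm_matrix_mult_diff_le:
  fixes A A' :: "real^'n^'m" and B B' :: "real^'k^'n"
  shows "norm (A ** B - A' ** B') \<le> norm (A - A') * norm B + norm A' * norm (B - B')"
proof -
  have "A ** B - A' ** B' = (A - A') ** B + A' ** (B - B')"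
    by (simp add: matrix_mult_diff_left matrix_mult_diff_right)
  also have "norm \<dots> \<le> norm ((A - A') ** B) + norm (A' ** (B - B'))"
    by (rule norm_triangle_ineq)
  also have "\<dots> \<le> norm (A - A') * norm B + norm A' * norm (B - B')"
    by (intro add_mono norm_matrix_mult_le)
  finally show ?thesis .
qed

lemma norm_matrix_le_of_entries:
  fixes A :: "real^'n^'m"
  assumes "\<And>i j. \<bar>A $ i $ j\<bar> \<le> b"
  shows "norm A \<le> real CARD('m) * real CARD('n) * b"
proof -
  have "norm (A $ i) \<le> real CARD('n) * b" for i
    using norm_le_l1_cart[of "A $ i"] sum_bounded_above[of UNIV "\<lambda>j. \<bar>A $ i $ j\<bar>" b] assms
    by force
  moreover have "norm A \<le> (\<Sum>i\<in>UNIV. norm (A $ i))"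
    unfolding norm_vec_def by (rule L2_set_le_sum) simp
  ultimately show ?thesis
    using sum_bounded_above[of UNIV "\<lambda>i. norm (A $ i)" "real CARD('n) * b"] by force
qed

lemma inner_symmetric_matrix:
  fixes M :: "real^'n^'n"
  assumes "transpose M = M"
  shows "x \<bullet> (M *v y) = (M *v x) \<bullet> y"
  using dot_lmul_matrix[of x M y] transpose_matrix_vector[of M x] assms by simp

lemma matrix_entry_eq_inner_axis:
  fixes M :: "real^'n^'m"
  shows "M $ i $ j = axis i 1 \<bullet> (M *v axis j 1)"
  by (simp add: inner_axis' matrix_vector_mul_component inner_axis)

text \<open>Polarisation bounds the entries of a symmetric matrix by its quadratic form.\<close>

lemma norm_le_of_quadratic_form_le:
  fixes M :: "real^'n^'n"
  assumes sym: "transpose M = M"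
    and lo: "\<And>x. 0 \<le> x \<bullet> (M *v x)"
    and up: "\<And>x. x \<bullet> (M *v x) \<le> b * (norm x)\<^sup>2"
  shows "norm M \<le> real CARD('n) * real CARD('n) * b"
proof (rule norm_matrix_le_of_entries)
  fix i j
  let ?x = "axis i 1 :: real^'n" and ?y = "axis j 1 :: real^'n"
  have "0 \<le> (?x + ?y) \<bullet> (M *v (?x + ?y))" "0 \<le> (?x - ?y) \<bullet> (M *v (?x - ?y))"
    by (rule lo)+
  moreover have "?y \<bullet> (M *v ?x) = ?x \<bullet> (M *v ?y)"
    using inner_symmetric_matrix[OF sym, of ?y ?x] by (simp add: inner_commute)
  moreover have "?x \<bullet> (M *v ?x) \<le> b" "?y \<bullet> (M *v ?y) \<le> b"
    using up[of ?x] up[of ?y] by (simp_all add: norm_axis_1)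
  ultimately have "\<bar>?x \<bullet> (M *v ?y)\<bar> \<le> b"
    by (simp add: algebra_simps inner_add_left inner_add_right inner_diff_left inner_diff_right
        abs_le_iff)
  then show "\<bar>M $ i $ j\<bar> \<le> b"
    by (simp add: matrix_entry_eq_inner_axis)
qed

lemma abs_inner_matrix_le:
  fixes M :: "real^'n^'n"
  shows "\<bar>x \<bullet> (M *v x)\<bar> \<le> norm M * (norm x)\<^sup>2"
proof -
  have "\<bar>x \<bullet> (M *v x)\<bar> \<le> norm x * norm (M *v x)" by (rule Cauchy_Schwarz_ineq2)
  also have "\<dots> \<le> norm x * (norm M * norm x)"
    by (intro mult_left_mono norm_matrix_vector_mult_le) simp
  finally show ?thesis by (simp add: power2_eq_square mult_ac)
qed

text \<open>For positive semidefinite \<open>M\<close> the quadratic form is minimal at \<open>x\<close>, so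
  its gradient \<open>2 M x\<close> vanishes there.\<close>

lemma psd_kernel:
  fixes M :: "real^'n^'n"
  assumes sym: "transpose M = M"
    and psd: "\<And>y. 0 \<le> y \<bullet> (M *v y)"
    and zero: "x \<bullet> (M *v x) = 0"
  shows "M *v x = 0"
proof (rule ccontr)
  assume nz: "M *v x \<noteq> 0"
  define w where "w = M *v x"
  define c where "c = w \<bullet> (M *v w)"
  have w0: "w \<bullet> w > 0" using nz by (simp add: w_def)
  have c0: "c \<ge> 0" unfolding c_def by (rule psd)
  \<comment> \<open>A step small enough for the linear gain \<open>2 s |w|\<^sup>2\<close> to beat the quadratic loss \<open>c s\<^sup>2\<close>;
    the summand 1 keeps the denominator positive.\<close>
  define s where "s = w \<bullet> w / (c + 1)"
  have s0: "s > 0" unfolding s_def using w0 c0 by simp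
  have "0 \<le> (x - s *\<^sub>R w) \<bullet> (M *v (x - s *\<^sub>R w))" by (rule psd)
  also have "\<dots> = - 2 * s * (w \<bullet> w) + s\<^sup>2 * c"
    using zero inner_symmetric_matrix[OF sym, of x w]
    by (simp add: w_def[symmetric] c_def algebra_simps inner_diff_left inner_diff_right
        power2_eq_square)
  finally have "s * (2 * (w \<bullet> w)) \<le> s * (s * c)" by (simp add: power2_eq_square algebra_simps)
  then have "2 * (w \<bullet> w) \<le> s * c" using s0 by simp
  moreover have "s * (c + 1) = w \<bullet> w" unfolding s_def using c0 by simp
  ultimately show False using w0 s0 by (simp add: algebra_simps)
qed

lemma matrix_inv_mult:
  fixes A :: "real^'n^'n"
  assumes "invertible A"
  shows "A ** matrix_inv A = mat 1" "matrix_inv A ** A = mat 1"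
  using assms unfolding invertible_def matrix_inv_def by (metis (mono_tags, lifting) someI_ex)+

lemma matrix_inv_right_vector:
  fixes A :: "real^'n^'n"
  assumes "invertible A"
  shows "A *v (matrix_inv A *v x) = x"
  using matrix_inv_mult[OF assms] by (simp add: matrix_vector_mul_assoc)

lemma spd_invertible:
  fixes M :: "real^'n^'n"
  assumes "spd M"
  shows "invertible M"
proof -
  have "\<forall>x. M *v x = 0 \<longrightarrow> x = 0"
    using assms unfolding spd_def by (metis inner_zero_right less_irrefl)
  then show ?thesis
    using matrix_left_invertible_ker[of M] invertible_left_inverse by blast
qed

lemma transpose_matrix_inv:
  fixes M :: "real^'n^'n"
  assumes inv: "invertible M" and sym: "transpose M = M"
  shows "transpose (matrix_inv M) = matrix_inv M"
proof -
  have "transpose (matrix_inv M) ** M = mat 1"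
    using arg_cong[OF matrix_inv_mult(1)[OF inv], of transpose]
    by (simp add: matrix_transpose_mul sym)
  then have "transpose (matrix_inv M) ** M ** matrix_inv M = matrix_inv M" by simp
  then show ?thesis
    using matrix_inv_mult(1)[OF inv] by (simp add: matrix_mul_assoc[symmetric])
qed

context
  fixes M :: "real^'n^'n" and a b :: real
  assumes sym: "transpose M = M" and a: "a > 0"
    and lo: "\<And>x. a * (norm x)\<^sup>2 \<le> x \<bullet> (M *v x)"
begin

lemma spd_of_form_bound: "spd M"
  unfolding spd_def using sym lo a
  by (metis less_le_trans zero_less_mult_iff zero_less_norm_iff zero_less_power)

lemma invertible_of_form_bound: "invertible M"
  using spd_of_form_bound by (rule spd_invertible)

lemma norm_matrix_inv_vector_le: "norm (matrix_inv M *v x) \<le> norm x / a"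
proof -
  let ?w = "matrix_inv M *v x"
  have "a * (norm ?w)\<^sup>2 \<le> ?w \<bullet> x"
    using lo[of ?w] matrix_inv_right_vector[OF invertible_of_form_bound] by simp
  also have "\<dots> \<le> norm ?w * norm x" by (rule norm_cauchy_schwarz)
  finally have "norm ?w * (a * norm ?w) \<le> norm ?w * norm x"
    by (simp add: power2_eq_square mult_ac)
  then have "a * norm ?w \<le> norm x"
    by (cases "?w = 0") simp_all
  then show ?thesis using a by (simp add: field_simps)
qed

lemma norm_matrix_inv_le: "norm (matrix_inv M) \<le> real CARD('n) * real CARD('n) / a"
proof -
  have "\<bar>matrix_inv M $ i $ j\<bar> \<le> 1 / a" for i j
  proof -
    have "\<bar>matrix_inv M $ i $ j\<bar> \<le> norm (axis i 1 :: real^'n) * norm (matrix_inv M *v axis j 1)"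
      unfolding matrix_entry_eq_inner_axis by (rule Cauchy_Schwarz_ineq2)
    also have "\<dots> \<le> 1 / a"
      using norm_matrix_inv_vector_le[of "axis j 1"] by (simp add: norm_axis_1)
    finally show ?thesis .
  qed
  from norm_matrix_le_of_entries[OF this] show ?thesis by simp
qed

lemma matrix_inv_form_le: "x \<bullet> (matrix_inv M *v x) \<le> (norm x)\<^sup>2 / a"
proof -
  have "x \<bullet> (matrix_inv M *v x) \<le> norm x * norm (matrix_inv M *v x)"
    by (rule norm_cauchy_schwarz)
  also have "\<dots> \<le> norm x * (norm x / a)"
    by (intro mult_left_mono norm_matrix_inv_vector_le) simp
  finally show ?thesis by (simp add: power2_eq_square)
qed

text \<open>With \<open>w = M\<^sup>-\<^sup>1 x\<close> the form of the inverse at \<open>x\<close> is the form of \<open>M\<close> at \<open>w\<close>, and \<open>|x| \<le> b |w|\<close>.\<close>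

lemma matrix_inv_form_ge:
  assumes nb: "norm M \<le> b" and b: "b > 0"
  shows "a / b\<^sup>2 * (norm x)\<^sup>2 \<le> x \<bullet> (matrix_inv M *v x)"
proof -
  let ?w = "matrix_inv M *v x"
  have Mw: "M *v ?w = x" by (rule matrix_inv_right_vector[OF invertible_of_form_bound])
  have "norm x \<le> norm M * norm ?w" using norm_matrix_vector_mult_le[of M ?w] Mw by simp
  also have "\<dots> \<le> b * norm ?w" using nb by (intro mult_right_mono) simp_all
  finally have "(norm x)\<^sup>2 \<le> b\<^sup>2 * (norm ?w)\<^sup>2"
    by (metis norm_ge_zero power_mono power_mult_distrib)
  then have "a / b\<^sup>2 * (norm x)\<^sup>2 \<le> a / b\<^sup>2 * (b\<^sup>2 * (norm ?w)\<^sup>2)"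
    using a by (intro mult_left_mono) simp_all
  also have "\<dots> = a * (norm ?w)\<^sup>2" using b by simp
  also have "\<dots> \<le> x \<bullet> ?w" using lo[of ?w] Mw by (simp add: inner_commute)
  finally show ?thesis .
qed

end

text \<open>Resolvent identity \<open>Q\<^sup>-\<^sup>1 - Q'\<^sup>-\<^sup>1 = Q\<^sup>-\<^sup>1 (Q' - Q) Q'\<^sup>-\<^sup>1\<close>.\<close>

lemma norm_matrix_inv_diff_le:
  fixes Q Q' :: "real^'n^'n"
  assumes "invertible Q" "invertible Q'"
  shows "norm (matrix_inv Q - matrix_inv Q')
    \<le> norm (matrix_inv Q) * norm (Q - Q') * norm (matrix_inv Q')"
proof -
  have "matrix_inv Q - matrix_inv Q' = matrix_inv Q ** (Q' - Q) ** matrix_inv Q'"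
    using matrix_inv_mult[OF assms(1)] matrix_inv_mult[OF assms(2)]
    by (simp add: matrix_mult_diff_left matrix_mult_diff_right matrix_mul_assoc[symmetric])
  also have "norm \<dots> \<le> norm (matrix_inv Q ** (Q' - Q)) * norm (matrix_inv Q')"
    by (rule norm_matrix_mult_le)
  also have "\<dots> \<le> norm (matrix_inv Q) * norm (Q' - Q) * norm (matrix_inv Q')"
    by (intro mult_right_mono norm_matrix_mult_le) simp
  finally show ?thesis by (simp add: norm_minus_commute)
qed

text \<open>The form attains its positive minimum on the compact product of the set of matrices with
  the unit sphere; homogeneity does the rest.\<close>

lemma compact_spd_uniform_bound:
  fixes Z :: "(real^'n^'n) set"
  assumes cZ: "compact Z" and Z: "\<And>M. M \<in> Z \<Longrightarrow> spd M"
  obtains a where "0 < a" "a \<le> 1" "\<And>M x. M \<in> Z \<Longrightarrow> a * (norm x)\<^sup>2 \<le> x \<bullet> (M *v x)"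
proof (cases "Z = {}")
  case True
  then show ?thesis using that[of 1] by simp
next
  case False
  let ?U = "Z \<times> sphere (0 :: real^'n) 1"
  let ?f = "\<lambda>p :: (real^'n^'n) \<times> (real^'n). snd p \<bullet> (fst p *v snd p)"
  have ne: "?U \<noteq> {}"
    using False by (auto simp: ex_in_conv[symmetric] intro: exI[of _ "axis undefined 1"] simp: norm_axis_1)
  have cont: "continuous_on ?U ?f"
    by (intro continuous_intros continuous_on_matrix_vector_mult)
  obtain p where p: "p \<in> ?U" "\<And>q. q \<in> ?U \<Longrightarrow> ?f p \<le> ?f q"
    using continuous_attains_inf[OF compact_Times[OF cZ compact_sphere] ne cont] by blast
  have pos: "?f p > 0"
  proof -
    have "fst p \<in> Z" "snd p \<noteq> 0" using p(1) by (auto simp: mem_Times_iff)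
    then show ?thesis using Z unfolding spd_def by blast
  qed
  have low: "?f p * (norm x)\<^sup>2 \<le> x \<bullet> (M *v x)" if "M \<in> Z" for M x
  proof (cases "x = 0")
    case False
    let ?y = "(1 / norm x) *\<^sub>R x"
    have "?f p \<le> ?y \<bullet> (M *v ?y)" using p(2)[of "(M, ?y)"] that False by simp
    also have "\<dots> = (x \<bullet> (M *v x)) / (norm x)\<^sup>2"
      by (simp add: algebra_simps power2_eq_square)
    finally show ?thesis using False by (simp add: field_simps)
  qed simp
  have "min (?f p) 1 * (norm x)\<^sup>2 \<le> x \<bullet> (M *v x)" if "M \<in> Z" for M x
    using mult_right_mono[of "min (?f p) 1" "?f p" "(norm x)\<^sup>2"] low[OF that, of x] by simp
  then show ?thesis using that[of "min (?f p) 1"] pos by simp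
qed

text \<open>The given norm is Lipschitz for the Euclidean one, hence attains a positive minimum on the
  compact unit sphere.\<close>

lemma is_norm_dominates:
  fixes \<nu> :: "'v::euclidean_space \<Rightarrow> real"
  assumes "is_norm \<nu>"
  obtains c where "c > 0" "\<And>v. norm v \<le> c * \<nu> v"
proof -
  have z: "\<nu> v = 0 \<longleftrightarrow> v = 0" and sc: "\<nu> (a *\<^sub>R v) = \<bar>a\<bar> * \<nu> v"
    and tri: "\<nu> (v + w) \<le> \<nu> v + \<nu> w" for v w a
    using assms by (auto simp: is_norm_def)
  have nn: "\<nu> v \<ge> 0" for v
    using tri[of v "- v"] sc[of "-1" v] z[of 0] by simp
  have sumle: "\<nu> (\<Sum>i\<in>F. f i) \<le> (\<Sum>i\<in>F. \<nu> (f i))" if "finite F" for f :: "'v \<Rightarrow> 'v" and F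
    using that
  proof induction
    case (insert i F)
    then show ?case using tri[of "f i" "\<Sum>i\<in>F. f i"] by simp
  qed (use z[of 0] in simp)
  define k where "k = (\<Sum>i\<in>Basis. \<nu> (i::'v)) + 1"
  have k: "k > 0" unfolding k_def using nn by (simp add: add_nonneg_pos sum_nonneg)
  have up: "\<nu> v \<le> k * norm v" for v
  proof -
    have "\<nu> v = \<nu> (\<Sum>i\<in>Basis. (v \<bullet> i) *\<^sub>R i)" by (simp add: euclidean_representation)
    also have "\<dots> \<le> (\<Sum>i\<in>Basis. \<bar>v \<bullet> i\<bar> * \<nu> i)"
      using sumle[of Basis "\<lambda>i. (v \<bullet> i) *\<^sub>R i"] by (simp add: sc)
    also have "\<dots> \<le> (\<Sum>i\<in>Basis. norm v * \<nu> i)"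
      by (intro sum_mono mult_right_mono nn Basis_le_norm) simp
    also have "\<dots> \<le> k * norm v"
      by (simp add: k_def sum_distrib_left[symmetric] algebra_simps)
    finally show ?thesis .
  qed
  have lip: "\<bar>\<nu> v - \<nu> w\<bar> \<le> k * dist v w" for v w
    using tri[of "v - w" w] tri[of "w - v" v] up[of "v - w"] up[of "w - v"]
    by (simp add: dist_norm norm_minus_commute abs_le_iff)
  have "k-lipschitz_on UNIV \<nu>"
    using lip k by (intro lipschitz_onI) (simp_all add: dist_real_def)
  then have cont: "continuous_on UNIV \<nu>" by (rule lipschitz_on_continuous_on)
  have ne: "sphere (0::'v) 1 \<noteq> {}"
    using nonempty_Basis norm_Basis by force
  obtain p where p: "p \<in> sphere (0::'v) 1" "\<And>q. q \<in> sphere 0 1 \<Longrightarrow> \<nu> p \<le> \<nu> q"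
    using continuous_attains_inf[OF compact_sphere ne continuous_on_subset[OF cont subset_UNIV]]
    by blast
  have pp: "\<nu> p > 0" using nn[of p] z[of p] p(1) by force
  have "norm v \<le> (1 / \<nu> p) * \<nu> v" for v
  proof (cases "v = 0")
    case False
    have "\<nu> p \<le> \<nu> ((1 / norm v) *\<^sub>R v)" using p(2) False by simp
    also have "\<dots> = \<nu> v / norm v" by (simp only: sc) simp
    finally show ?thesis using False pp by (simp add: field_simps)
  qed (use z[of 0] in simp)
  then show ?thesis using that[of "1 / \<nu> p"] pp by simp
qed

section \<open>Two comparison principles\<close>

text \<open>The rate \<open>2 L\<close> instead of the sharp \<open>L\<close> makes a short proof possible: inserting the maximum
  \<open>m\<close> of \<open>u(s) exp(-2 L s)\<close> into the integral bound reproduces only half of it, so that \<open>m\<close> can be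
  absorbed.\<close>

lemma gronwall_integral:
  fixes u :: "real \<Rightarrow> real"
  assumes L: "L > 0" and a: "a \<ge> 0"
    and cont: "continuous_on {0..T} u"
    and bound: "\<And>t. t \<in> {0..T} \<Longrightarrow> u t \<le> a + L * integral {0..t} u"
    and t: "t \<in> {0..T}"
  shows "u t \<le> a * exp (2 * L * t)"
proof -
  have ne: "{0..T} \<noteq> {}" using t by auto
  have "continuous_on {0..T} (\<lambda>s. u s * exp (- 2 * L * s))"
    by (intro continuous_intros cont)
  from continuous_attains_sup[OF compact_Icc ne this]
  obtain \<tau> where \<tau>: "\<tau> \<in> {0..T}"
    and max: "\<And>s. s \<in> {0..T} \<Longrightarrow> u s * exp (- 2 * L * s) \<le> u \<tau> * exp (- 2 * L * \<tau>)"
    by blast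
  define m where "m = u \<tau> * exp (- 2 * L * \<tau>)"
  have um: "u s \<le> m * exp (2 * L * s)" if "s \<in> {0..T}" for s
    using mult_right_mono[OF max[OF that], of "exp (2 * L * s)"]
    by (simp add: m_def mult.assoc exp_add[symmetric])
  have uT: "u \<tau> = m * exp (2 * L * \<tau>)"
    by (simp add: m_def mult.assoc exp_add[symmetric])
  have "m \<le> a"
  proof (cases "m \<le> 0")
    case False
    have int: "((\<lambda>s. m * exp (2 * L * s)) has_integral
        (m / (2 * L) * exp (2 * L * \<tau>) - m / (2 * L) * exp (2 * L * 0))) {0..\<tau>}"
      using \<tau> L
      by (intro fundamental_theorem_of_calculus)
        (auto intro!: derivative_eq_intros simp: has_real_derivative_iff_has_vector_derivative[symmetric])
    have "integral {0..\<tau>} u \<le> integral {0..\<tau>} (\<lambda>s. m * exp (2 * L * s))"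
      using \<tau> um int
      by (intro integral_le integrable_continuous_interval continuous_on_subset[OF cont])
        (auto intro!: continuous_intros)
    also have "\<dots> = (m * exp (2 * L * \<tau>) - m) / (2 * L)"
      using integral_unique[OF int] by (simp add: diff_divide_distrib)
    finally have "L * integral {0..\<tau>} u \<le> L * ((m * exp (2 * L * \<tau>) - m) / (2 * L))"
      using L by (intro mult_left_mono) simp_all
    then have "m * exp (2 * L * \<tau>) + m \<le> 2 * a"
      using bound[OF \<tau>] uT L by simp
    moreover have "m \<le> m * exp (2 * L * \<tau>)" using False L \<tau> by simp
    ultimately show ?thesis by simp
  qed (use a in simp)
  then show ?thesis
    by (intro order_trans[OF um[OF t]] mult_right_mono) simp_all
qed

text \<open>The differential inequality is only required almost everywhere, since the weak derivative
  of the observer state is only determined up to null sets.\<close>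

lemma gronwall_weak_derivative:
  fixes x g :: "real \<Rightarrow> 'v::euclidean_space"
  assumes L: "L > 0"
    and g: "g integrable_on {0..T}"
    and x: "\<And>t. t \<in> {0..T} \<Longrightarrow> x t = x 0 + integral {0..t} g"
    and h: "h integrable_on {0..T}" and h0: "\<And>s. s \<in> {0..T} \<Longrightarrow> 0 \<le> h s"
    and N: "negligible N"
    and gb: "\<And>s. s \<in> {0..T} - N \<Longrightarrow> norm (g s) \<le> L * norm (x s) + h s"
    and t: "t \<in> {0..T}"
  shows "norm (x t) \<le> (norm (x 0) + integral {0..T} h) * exp (2 * L * T)"
proof -
  have contx: "continuous_on {0..T} x"
    using continuous_on_add[OF continuous_on_const[of _ "x 0"] indefinite_integral_continuous_1[OF g]]
    by (rule continuous_on_eq) (metis x)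
  then have cont: "continuous_on {0..T} (\<lambda>s. norm (x s))" by (rule continuous_on_norm)
  have H0: "0 \<le> integral {0..T} h" using h h0 by (rule integral_nonneg)
  have bound: "norm (x s) \<le> (norm (x 0) + integral {0..T} h) + L * integral {0..s} (\<lambda>s. norm (x s))"
    if s: "s \<in> {0..T}" for s
  proof -
    have sub: "{0..s} \<subseteq> {0..T}" using s by auto
    let ?g = "\<lambda>r. if r \<in> N then 0 else g r"
    have gi: "g integrable_on {0..s}" using g sub by (rule integrable_on_subinterval)
    have hi: "h integrable_on {0..s}" using h sub by (rule integrable_on_subinterval)
    have xi: "(\<lambda>s. norm (x s)) integrable_on {0..s}"
      using continuous_on_subset[OF cont sub] by (rule integrable_continuous_interval)
    have g'i: "?g integrable_on {0..s}"
      by (rule integrable_spike[OF gi N]) simp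
    have eq: "integral {0..s} ?g = integral {0..s} g"
      by (rule integral_spike[OF N]) simp
    have ri: "(\<lambda>r. L * norm (x r)) integrable_on {0..s}"
      using integrable_cmul[OF xi, of L] by simp
    have "norm (integral {0..s} ?g) \<le> integral {0..s} (\<lambda>r. L * norm (x r) + h r)"
    proof (rule integral_norm_bound_integral[OF g'i integrable_add[OF ri hi]])
      fix r assume "r \<in> {0..s}"
      then have "r \<in> {0..T}" using sub by auto
      then show "norm (?g r) \<le> L * norm (x r) + h r" using gb[of r] h0[of r] L by simp
    qed
    also have "\<dots> = L * integral {0..s} (\<lambda>r. norm (x r)) + integral {0..s} h"
      by (simp add: integral_add[OF ri hi])
    also have "integral {0..s} h \<le> integral {0..T} h"
      using integral_subset_le[OF sub hi h] h0 by simp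
    finally have "norm (integral {0..s} g) \<le> L * integral {0..s} (\<lambda>r. norm (x r)) + integral {0..T} h"
      using eq by simp
    then show ?thesis
      using x[OF s] norm_triangle_ineq[of "x 0" "integral {0..s} g"] by simp
  qed
  have "norm (x t) \<le> (norm (x 0) + integral {0..T} h) * exp (2 * L * t)"
    using gronwall_integral[OF L _ cont bound t] H0 by simp
  also have "\<dots> \<le> (norm (x 0) + integral {0..T} h) * exp (2 * L * T)"
    using t L H0 by (intro mult_left_mono) auto
  finally show ?thesis .
qed

lemma bounded_linear_quadratic_form:
  fixes x :: "real^'n"
  shows "bounded_linear (\<lambda>M :: real^'n^'n. x \<bullet> (M *v x))"
  by (intro bounded_linear_inner_right_comp
      bounded_bilinear.bounded_linear_left[OF bounded_bilinear_matrix_vector_mult])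

text \<open>At the first time where the form degenerates, the degenerate direction \<open>x\<close> lies in the
  kernel of the still semidefinite matrix. The form at \<open>x\<close> was positive before and is \<open>0\<close> now, so it
  cannot have a positive derivative there.\<close>

lemma spd_barrier:
  fixes M M' :: "real \<Rightarrow> real^'n^'n"
  assumes der: "\<And>t. t \<in> {0..T} \<Longrightarrow> (M has_vector_derivative M' t) (at t within {0..T})"
    and sym: "\<And>t. t \<in> {0..T} \<Longrightarrow> transpose (M t) = M t"
    and init: "spd (M 0)"
    and touch: "\<And>t x. t \<in> {0..T} \<Longrightarrow> norm x = 1 \<Longrightarrow> M t *v x = 0 \<Longrightarrow> x \<bullet> (M' t *v x) > 0"
    and t: "t \<in> {0..T}"
  shows "spd (M t)"
proof -
  let ?f = "\<lambda>t x. x \<bullet> (M t *v x)"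
  let ?S = "{p \<in> {0..T} \<times> sphere (0 :: real^'n) 1. ?f (fst p) (snd p) \<le> 0}"
  have contM: "continuous_on {0..T} M"
    unfolding continuous_on_eq_continuous_within
    by (intro ballI has_vector_derivative_continuous[OF der])
  have contp: "continuous_on ({0..T} \<times> sphere (0 :: real^'n) 1) (\<lambda>p. ?f (fst p) (snd p))"
  proof (intro continuous_intros continuous_on_matrix_vector_mult)
    show "continuous_on ({0..T} \<times> sphere (0 :: real^'n) 1) (\<lambda>p. M (fst p))"
      by (rule continuous_on_compose2[OF contM continuous_on_fst[OF continuous_on_id]]) auto
  qed
  have "closed ?S"
    by (rule continuous_on_closed_Collect_le[OF contp continuous_on_const])
      (simp add: closed_Times)
  then have "compact (({0..T} \<times> sphere 0 1) \<inter> ?S)"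
    by (rule compact_Int_closed[OF compact_Times[OF compact_Icc compact_sphere]])
  moreover have "({0..T} \<times> sphere 0 1) \<inter> ?S = ?S" by (intro Int_absorb1 subsetI) (simp add: mem_Times_iff)
  ultimately have "compact ?S" by (simp only:)
  have "?S = {}"
  proof (rule ccontr)
    assume ne: "?S \<noteq> {}"
    obtain p where p: "p \<in> ?S" "\<And>q. q \<in> ?S \<Longrightarrow> fst p \<le> fst q"
      using continuous_attains_inf[OF \<open>compact ?S\<close> ne continuous_on_fst[OF continuous_on_id]]
      by blast
    define \<tau> x where "\<tau> = fst p" and "x = snd p"
    have \<tau>: "\<tau> \<in> {0..T}" and x: "norm x = 1" and fx: "?f \<tau> x \<le> 0"
      using p(1) by (auto simp: \<tau>_def x_def)
    have before: "?f s y > 0" if "s \<in> {0..T}" "s < \<tau>" "norm y = 1" for s y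
    proof (rule ccontr)
      assume "\<not> ?f s y > 0"
      then have "(s, y) \<in> ?S" using that by simp
      from p(2)[OF this] show False using that by (simp add: \<tau>_def)
    qed
    have "x \<noteq> 0" using x by auto
    then have "?f 0 x > 0" using init unfolding spd_def by blast
    then have "\<tau> \<noteq> 0" using fx by auto
    then have \<tau>0: "\<tau> > 0" using \<tau> by simp
    have cl: "closure {0..<\<tau>} = {0..\<tau>}" using \<tau>0 by simp
    have unit: "?f \<tau> y \<ge> 0" if "norm y = 1" for y
    proof (rule continuous_ge_on_closure[where S = "{0..<\<tau>}" and f = "\<lambda>s. ?f s y"])
      show "continuous_on (closure {0..<\<tau>}) (\<lambda>s. ?f s y)"
        unfolding cl using \<tau>
        by (intro continuous_on_inner continuous_on_const continuous_on_matrix_vector_mult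
            continuous_on_subset[OF contM]) auto
      show "\<tau> \<in> closure {0..<\<tau>}" unfolding cl using \<tau>0 by simp
      show "0 \<le> ?f s y" if "s \<in> {0..<\<tau>}" for s
        using before[of s y] that \<open>norm y = 1\<close> \<tau> by force
    qed
    have psd: "?f \<tau> y \<ge> 0" for y
    proof (cases "y = 0")
      case False
      have "0 \<le> ?f \<tau> ((1 / norm y) *\<^sub>R y)" using False by (intro unit) simp
      also have "\<dots> = ?f \<tau> y / (norm y)\<^sup>2" by (simp add: algebra_simps power2_eq_square)
      finally show ?thesis using False by (simp add: zero_le_divide_iff)
    qed simp
    have fx0: "?f \<tau> x = 0" using psd[of x] fx by simp
    have "M \<tau> *v x = 0" by (rule psd_kernel[OF sym[OF \<tau>] psd fx0])
    then have pos: "x \<bullet> (M' \<tau> *v x) > 0" by (rule touch[OF \<tau> x])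
    have "((\<lambda>s. ?f s x) has_real_derivative x \<bullet> (M' \<tau> *v x)) (at \<tau> within {0..T})"
      unfolding has_real_derivative_iff_has_vector_derivative
      by (rule bounded_linear.has_vector_derivative[OF bounded_linear_quadratic_form der[OF \<tau>]])
    from has_real_derivative_pos_inc_left[OF this pos]
    obtain d where d: "d > 0" "\<And>h. h > 0 \<Longrightarrow> \<tau> - h \<in> {0..T} \<Longrightarrow> h < d \<Longrightarrow> ?f (\<tau> - h) x < ?f \<tau> x"
      by blast
    define h where "h = min (d / 2) \<tau>"
    have h: "h > 0" "h < d" "\<tau> - h \<in> {0..T}" "\<tau> - h < \<tau>"
      using d(1) \<tau>0 \<tau> by (auto simp: h_def)
    show False using d(2)[OF h(1,3,2)] before[OF h(3,4) x] fx0 by simp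
  qed
  have unit: "?f t y > 0" if "norm y = 1" for y
  proof (rule ccontr)
    assume "\<not> ?f t y > 0"
    then have "(t, y) \<in> ?S" using that t by simp
    then show False using \<open>?S = {}\<close> by blast
  qed
  have "?f t y > 0" if "y \<noteq> 0" for y
  proof -
    have "0 < ?f t ((1 / norm y) *\<^sub>R y)" using that by (intro unit) simp
    also have "\<dots> = ?f t y / (norm y)\<^sup>2" by (simp add: algebra_simps power2_eq_square)
    finally show ?thesis using that by (simp add: zero_less_divide_iff)
  qed
  then show ?thesis using sym[OF t] by (simp add: spd_def)
qed

section \<open>The Riccati equation\<close>

definition riccati_rhs ::
  "real^'n^'n \<Rightarrow> real^'n^'n \<Rightarrow> real^'n^'n \<Rightarrow> real^'n^'n \<Rightarrow> real^'n^'n" where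
  "riccati_rhs A G W P = A ** P + P ** transpose A - P ** G ** P + W"

definition riccati_ode ::
  "real \<Rightarrow> real^'n^'n \<Rightarrow> real^'n^'n \<Rightarrow> real^'n^'n \<Rightarrow> (real \<Rightarrow> real^'n^'n) \<Rightarrow> bool" where
  "riccati_ode T A G W P \<longleftrightarrow>
     (\<forall>t\<in>{0..T}. (P has_vector_derivative riccati_rhs A G W (P t)) (at t within {0..T}))"

lemma norm_riccati_rhs_diff_le:
  fixes P1 P2 :: "real^'n^'n"
  assumes M: "norm A2 \<le> M" "norm G1 \<le> M" "norm G2 \<le> M" "norm P1 \<le> M" "norm P2 \<le> M"
    and M1: "norm A1 \<le> M"
  shows "norm (riccati_rhs A1 G1 W1 P1 - riccati_rhs A2 G2 W2 P2)
    \<le> (2 * M + 2 * M\<^sup>2) * norm (P1 - P2)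
      + (2 * M + M\<^sup>2 + 1) * (norm (A1 - A2) + norm (G1 - G2) + norm (W1 - W2))"
proof -
  define D a g w where "D = norm (P1 - P2)" and "a = norm (A1 - A2)" and "g = norm (G1 - G2)"
    and "w = norm (W1 - W2)"
  have nn: "0 \<le> D" "0 \<le> a" "0 \<le> g" "0 \<le> w" by (simp_all add: D_def a_def g_def w_def)
  have M0: "0 \<le> M" using M(1) norm_ge_zero order_trans by blast
  have ta: "norm (transpose A1 - transpose A2) = a"
    unfolding a_def using norm_transpose[of "A1 - A2"]
    by (simp add: transpose_diff[symmetric])
  have 1: "norm (A1 ** P1 - A2 ** P2) \<le> a * M + M * D"
    unfolding a_def D_def
    by (rule order_trans[OF norm_matrix_mult_diff_le]) (intro add_mono mult_mono M; simp add: M0)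
  have 2: "norm (P1 ** transpose A1 - P2 ** transpose A2) \<le> D * M + M * a"
    unfolding ta[symmetric] D_def
    by (rule order_trans[OF norm_matrix_mult_diff_le])
      (intro add_mono mult_mono M; simp add: M0 norm_transpose M1)
  have 3: "norm (P1 ** G1 - P2 ** G2) \<le> D * M + M * g"
    unfolding g_def D_def
    by (rule order_trans[OF norm_matrix_mult_diff_le]) (intro add_mono mult_mono M; simp add: M0)
  have PG: "norm (P2 ** G2) \<le> M * M"
    by (rule order_trans[OF norm_matrix_mult_le]) (intro mult_mono M; simp add: M0)
  have 4: "norm (P1 ** G1 ** P1 - P2 ** G2 ** P2) \<le> (D * M + M * g) * M + (M * M) * D"
    unfolding D_def[symmetric]
    by (rule order_trans[OF norm_matrix_mult_diff_le], fold D_def)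
      (intro add_mono mult_mono M 3 PG; simp add: M0 nn)
  let ?X = "A1 ** P1 - A2 ** P2" and ?Y = "P1 ** transpose A1 - P2 ** transpose A2"
    and ?Z = "P1 ** G1 ** P1 - P2 ** G2 ** P2"
  have split: "riccati_rhs A1 G1 W1 P1 - riccati_rhs A2 G2 W2 P2 =
      ?X + ?Y - ?Z + (W1 - W2)"
    by (simp add: riccati_rhs_def)
  have "norm (riccati_rhs A1 G1 W1 P1 - riccati_rhs A2 G2 W2 P2)
      \<le> norm ?X + norm ?Y + norm ?Z + w"
    unfolding split w_def
    using norm_triangle_ineq[of ?X ?Y] norm_triangle_ineq4[of "?X + ?Y" ?Z]
      norm_triangle_ineq[of "?X + ?Y - ?Z" "W1 - W2"] by linarith
  also have "\<dots> \<le> (a * M + M * D) + (D * M + M * a) + ((D * M + M * g) * M + (M * M) * D) + w"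
    using 1 2 4 by linarith
  also have "\<dots> = (2 * M + 2 * M\<^sup>2) * D + (2 * M * a + M\<^sup>2 * g + w)"
    by (simp add: algebra_simps power2_eq_square)
  also have "2 * M * a + M\<^sup>2 * g + w \<le> (2 * M + M\<^sup>2 + 1) * a + (2 * M + M\<^sup>2 + 1) * g + (2 * M + M\<^sup>2 + 1) * w"
    using M0 nn by (intro add_mono mult_right_mono mult_right_mono[of 1 _ w, simplified]) simp_all
  finally show ?thesis by (simp add: D_def a_def g_def w_def distrib_left add.assoc)
qed

lemma riccati_continuous:
  assumes "riccati_ode T A G W P"
  shows "continuous_on {0..T} P"
  using assms unfolding continuous_on_eq_continuous_within riccati_ode_def
  by (auto dest!: bspec intro: has_vector_derivative_continuous)

definition riccati_lipschitz_const :: "real \<Rightarrow> real \<Rightarrow> real" where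
  "riccati_lipschitz_const T M =
     (1 + T * (2 * M + M\<^sup>2 + 1)) * exp (2 * (2 * M + 2 * M\<^sup>2) * T)"

text \<open>The assumed a priori bounds \<open>M\<close> on both solutions are what makes the quadratic term
  globally Lipschitz here.\<close>

lemma riccati_lipschitz:
  fixes P1 P2 :: "real \<Rightarrow> real^'n^'n"
  assumes M0: "M > 0"
    and ode1: "riccati_ode T A1 G1 W1 P1" and ode2: "riccati_ode T A2 G2 W2 P2"
    and M: "norm A1 \<le> M" "norm A2 \<le> M" "norm G1 \<le> M" "norm G2 \<le> M"
    and P1: "\<And>t. t \<in> {0..T} \<Longrightarrow> norm (P1 t) \<le> M"
    and P2: "\<And>t. t \<in> {0..T} \<Longrightarrow> norm (P2 t) \<le> M"
    and t: "t \<in> {0..T}"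
  shows "norm (P1 t - P2 t) \<le> riccati_lipschitz_const T M *
    (norm (P1 0 - P2 0) + norm (A1 - A2) + norm (G1 - G2) + norm (W1 - W2))"
proof -
  define \<delta> where "\<delta> = norm (A1 - A2) + norm (G1 - G2) + norm (W1 - W2)"
  define c where "c = 2 * M + M\<^sup>2 + 1"
  define L where "L = 2 * M + 2 * M\<^sup>2"
  let ?D = "\<lambda>t. P1 t - P2 t"
  let ?g = "\<lambda>t. riccati_rhs A1 G1 W1 (P1 t) - riccati_rhs A2 G2 W2 (P2 t)"
  have T: "0 \<le> T" using t by auto
  have L: "L > 0" and c0: "c \<ge> 0" and \<delta>0: "\<delta> \<ge> 0"
    using M0 by (simp_all add: L_def c_def \<delta>_def add_pos_pos)
  have int: "(?g has_integral (?D s - ?D 0)) {0..s}" if "s \<in> {0..T}" for s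
  proof (rule fundamental_theorem_of_calculus)
    show "0 \<le> s" using that by simp
    fix r assume "r \<in> {0..s}"
    then have r: "r \<in> {0..T}" and sub: "{0..s} \<subseteq> {0..T}" using that by auto
    show "(?D has_vector_derivative ?g r) (at r within {0..s})"
      using ode1 ode2 r unfolding riccati_ode_def
      by (intro has_vector_derivative_within_subset[OF _ sub] has_vector_derivative_diff) auto
  qed
  have gb: "norm (?g s) \<le> L * norm (?D s) + c * \<delta>" if "s \<in> {0..T} - {}" for s
    unfolding L_def c_def \<delta>_def
    using that by (intro norm_riccati_rhs_diff_le M P1 P2) auto
  have "norm (?D t) \<le> (norm (?D 0) + integral {0..T} (\<lambda>_. c * \<delta>)) * exp (2 * L * T)"
  proof (rule gronwall_weak_derivative[OF L _ _ _ _ negligible_empty gb t])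
    show "?g integrable_on {0..T}" using int[of T] T by auto
    show "?D s = ?D 0 + integral {0..s} ?g" if "s \<in> {0..T}" for s
      using integral_unique[OF int[OF that]] by simp
  qed (use c0 \<delta>0 in auto)
  also have "integral {0..T} (\<lambda>_. c * \<delta>) = (T * c) * \<delta>" using T by simp
  also have "norm (?D 0) + (T * c) * \<delta> \<le> (1 + T * c) * (norm (?D 0) + \<delta>)"
    using T c0 \<delta>0 by (simp add: algebra_simps)
  finally show ?thesis
    by (simp add: riccati_lipschitz_const_def L_def c_def \<delta>_def mult_ac add.assoc)
qed

text \<open>The transpose solves the same equation, so symmetry is a case of uniqueness.\<close>

lemma riccati_symmetric:
  fixes P :: "real \<Rightarrow> real^'n^'n"
  assumes ode: "riccati_ode T A G W P"
    and sG: "transpose G = G" and sW: "transpose W = W" and s0: "transpose (P 0) = P 0"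
    and t: "t \<in> {0..T}"
  shows "transpose (P t) = P t"
proof -
  have tr: "transpose (riccati_rhs A G W X) = riccati_rhs A G W (transpose X)" for X
    unfolding riccati_rhs_def
    by (simp add: transpose_diff transpose_add matrix_transpose_mul sG sW matrix_mul_assoc)
  have ode': "riccati_ode T A G W (\<lambda>t. transpose (P t))"
    using ode unfolding riccati_ode_def tr[symmetric]
    by (simp add: bounded_linear.has_vector_derivative[OF bounded_linear_transpose])
  have "bounded (P ` {0..T})"
    by (intro compact_imp_bounded compact_continuous_image riccati_continuous[OF ode] compact_Icc)
  then obtain m where m: "\<And>t. t \<in> {0..T} \<Longrightarrow> norm (P t) \<le> m"
    unfolding bounded_iff by blast
  define M where "M = \<bar>m\<bar> + norm A + norm G + 1"
  have M0: "M > 0" by (simp add: M_def add_nonneg_pos)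
  have b: "norm (P s) \<le> M" if "s \<in> {0..T}" for s
    using m[OF that] norm_ge_zero[of A] norm_ge_zero[of G] unfolding M_def by linarith
  have "norm (P t - transpose (P t)) \<le> 0"
    using riccati_lipschitz[OF M0 ode ode' _ _ _ _ b _ t] b
    by (simp add: norm_transpose s0 M_def)
  then show ?thesis by simp
qed

text \<open>Along an eigenvector, the matrix equation becomes the scalar Riccati equation for the
  eigenvalue.\<close>

lemma riccati_form_at_eigenvector:
  fixes P :: "real^'n^'n"
  assumes sym: "transpose P = P" and eig: "P *v x = \<mu> *\<^sub>R x"
  shows "x \<bullet> (riccati_rhs A G W P *v x)
    = 2 * \<mu> * (x \<bullet> (A *v x)) - \<mu>\<^sup>2 * (x \<bullet> (G *v x)) + x \<bullet> (W *v x)"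
proof -
  have P: "x \<bullet> (P *v y) = \<mu> * (x \<bullet> y)" for y
    using inner_symmetric_matrix[OF sym, of x y] eig by simp
  have 1: "x \<bullet> ((A ** P) *v x) = \<mu> * (x \<bullet> (A *v x))"
    by (simp add: matrix_vector_mul_assoc[symmetric] eig matrix_vector_mult_scaleR)
  have 2: "x \<bullet> ((P ** transpose A) *v x) = \<mu> * (x \<bullet> (A *v x))"
    using P[of "x v* A"] dot_lmul_matrix[of x A x]
    by (simp add: matrix_vector_mul_assoc[symmetric] inner_commute)
  have 3: "x \<bullet> ((P ** G ** P) *v x) = \<mu>\<^sup>2 * (x \<bullet> (G *v x))"
    by (simp add: matrix_vector_mul_assoc[symmetric] eig matrix_vector_mult_scaleR P power2_eq_square)
  show ?thesis
    unfolding riccati_rhs_def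
    by (simp add: matrix_vector_mult_add_rdistrib matrix_vector_mult_diff_rdistrib
        inner_add_right inner_diff_right 1 2 3)
qed

lemma scaleR_mat_vector: "((c *\<^sub>R mat 1) :: real^'n^'n) *v x = c *\<^sub>R x"
  by (simp add: scaleR_matrix_vector_assoc[symmetric])

lemma has_vector_derivative_scaleR_const:
  fixes f :: "real \<Rightarrow> real"
  assumes "(f has_real_derivative f') (at s within S)"
  shows "((\<lambda>s. f s *\<^sub>R C) has_vector_derivative f' *\<^sub>R C) (at s within S)"
  using has_vector_derivative_scaleR[OF assms has_vector_derivative_const[of C]] by simp

context
  fixes P :: "real \<Rightarrow> real^'n^'n" and A G W :: "real^'n^'n" and a M T :: real
  assumes ode: "riccati_ode T A G W P"
    and sG: "transpose G = G" and sW: "transpose W = W" and s0: "transpose (P 0) = P 0"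
    and pG: "\<And>x. 0 \<le> x \<bullet> (G *v x)" and pW: "\<And>x. 0 \<le> x \<bullet> (W *v x)"
    and M: "norm A \<le> M" "norm G \<le> M" "norm W \<le> M" "norm (P 0) \<le> M"
    and a: "0 < a" "a \<le> 1" and lo: "\<And>x. a * (norm x)\<^sup>2 \<le> x \<bullet> (P 0 *v x)"
begin

private lemma M_nonneg: "0 \<le> M"
  using M(1) norm_ge_zero order_trans by blast

private lemmas sym = riccati_symmetric[OF ode sG sW s0]

text \<open>At a degenerate unit direction of \<open>P(t) - \<mu>(t) I\<close> with \<open>\<mu>(t) = (a/2) exp(-(3M+1)t) \<le> 1\<close>, the
  form of \<open>P'\<close> is at least \<open>- 2 M \<mu> - M \<mu>\<^sup>2 \<ge> - 3 M \<mu>\<close>, which exceeds \<open>\<mu>' = - (3M+1) \<mu>\<close>.\<close>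

lemma riccati_lower_bound:
  assumes t: "t \<in> {0..T}"
  shows "a / 2 * exp (- (3 * M + 1) * T) * (norm x)\<^sup>2 \<le> x \<bullet> (P t *v x)"
proof -
  define L where "L = 3 * M + 1"
  have L0: "L > 0" using M_nonneg by (simp add: L_def)
  \<comment> \<open>Half of \<open>a\<close>, so that the inequality is strict at time 0.\<close>
  define \<mu> where "\<mu> s = a / 2 * exp (- L * s)" for s
  have d\<mu>: "(\<mu> has_real_derivative - L * \<mu> s) (at s within {0..T})" for s
    unfolding \<mu>_def by (auto intro!: derivative_eq_intros)
  have "spd (P t - \<mu> t *\<^sub>R mat 1)"
  proof (rule spd_barrier[where M = "\<lambda>s. P s - \<mu> s *\<^sub>R mat 1"
        and M' = "\<lambda>s. riccati_rhs A G W (P s) - (- L * \<mu> s) *\<^sub>R mat 1", OF _ _ _ _ t])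
    fix s assume s: "s \<in> {0..T}"
    show "((\<lambda>s. P s - \<mu> s *\<^sub>R mat 1) has_vector_derivative
        riccati_rhs A G W (P s) - (- L * \<mu> s) *\<^sub>R mat 1) (at s within {0..T})"
      using ode s unfolding riccati_ode_def
      by (intro has_vector_derivative_diff has_vector_derivative_scaleR_const d\<mu>) blast
    show "transpose (P s - \<mu> s *\<^sub>R mat 1) = P s - \<mu> s *\<^sub>R mat 1"
      by (simp add: transpose_diff transpose_scalar sym[OF s])
    fix x :: "real^'n" assume x: "norm x = 1" and ker: "(P s - \<mu> s *\<^sub>R mat 1) *v x = 0"
    have \<mu>0: "\<mu> s > 0" using a by (simp add: \<mu>_def)
    have "\<mu> s \<le> 1 * 1"
      unfolding \<mu>_def using a s L0 by (intro mult_mono) auto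
    then have \<mu>2: "(\<mu> s)\<^sup>2 \<le> \<mu> s" using \<mu>0 by (simp add: power2_eq_square)
    have eig: "P s *v x = \<mu> s *\<^sub>R x"
      using ker by (simp add: matrix_vector_mult_diff_rdistrib scaleR_mat_vector)
    have "\<bar>x \<bullet> (A *v x)\<bar> \<le> M" "\<bar>x \<bullet> (G *v x)\<bar> \<le> M"
      using abs_inner_matrix_le[of x A] abs_inner_matrix_le[of x G] M x by auto
    then have "\<mu> s * (x \<bullet> (A *v x)) \<ge> \<mu> s * (- M)" "(\<mu> s)\<^sup>2 * (x \<bullet> (G *v x)) \<le> \<mu> s * M"
      using \<mu>0 \<mu>2 pG by (intro mult_left_mono mult_mono; simp add: abs_le_iff)+
    then have "x \<bullet> (riccati_rhs A G W (P s) *v x) \<ge> - 3 * M * \<mu> s"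
      unfolding riccati_form_at_eigenvector[OF sym[OF s] eig] using pW[of x]
      by (simp add: algebra_simps)
    moreover have "x \<bullet> x = 1" using x by (simp add: power2_norm_eq_inner[symmetric])
    ultimately show "0 < x \<bullet> ((riccati_rhs A G W (P s) - (- L * \<mu> s) *\<^sub>R mat 1) *v x)"
      using \<mu>0 by (simp add: matrix_vector_mult_diff_rdistrib matrix_vector_mult_add_rdistrib
          scaleR_mat_vector inner_diff_right inner_add_right L_def algebra_simps)
  next
    have "x \<bullet> ((P 0 - \<mu> 0 *\<^sub>R mat 1) *v x) > 0" if "x \<noteq> 0" for x
    proof -
      have "a / 2 * (norm x)\<^sup>2 < a * (norm x)\<^sup>2" using a that by simp
      also have "\<dots> \<le> x \<bullet> (P 0 *v x)" by (rule lo)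
      finally show ?thesis
        by (simp add: \<mu>_def matrix_vector_mult_diff_rdistrib scaleR_mat_vector inner_diff_right
            power2_norm_eq_inner)
    qed
    then show "spd (P 0 - \<mu> 0 *\<^sub>R mat 1)"
      by (simp add: spd_def transpose_diff transpose_scalar s0)
  qed
  then have "0 \<le> x \<bullet> ((P t - \<mu> t *\<^sub>R mat 1) *v x)"
    unfolding spd_def by (cases "x = 0") (auto intro: less_imp_le)
  then have "\<mu> t * (norm x)\<^sup>2 \<le> x \<bullet> (P t *v x)"
    by (simp add: matrix_vector_mult_diff_rdistrib scaleR_mat_vector inner_diff_right
        power2_norm_eq_inner)
  moreover have "a / 2 * exp (- L * T) \<le> \<mu> t"
    unfolding \<mu>_def using a L0 t by (intro mult_left_mono) auto
  ultimately show ?thesis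
    using mult_right_mono[of "a / 2 * exp (- L * T)" "\<mu> t" "(norm x)\<^sup>2"] by (simp add: L_def)
qed

text \<open>Now the quadratic term only helps: at a degenerate unit direction of \<open>\<mu>(t) I - P(t)\<close> with
  \<open>\<mu>(t) = (M+1) exp((3M+1)t) \<ge> 1\<close>, the form of \<open>P'\<close> is at most \<open>2 M \<mu> + M \<le> 3 M \<mu> < \<mu>'\<close>.\<close>

lemma riccati_upper_bound:
  assumes t: "t \<in> {0..T}"
  shows "x \<bullet> (P t *v x) \<le> (M + 1) * exp ((3 * M + 1) * T) * (norm x)\<^sup>2"
proof -
  define L where "L = 3 * M + 1"
  have L0: "L > 0" using M_nonneg by (simp add: L_def)
  define \<mu> where "\<mu> s = (M + 1) * exp (L * s)" for s
  have d\<mu>: "(\<mu> has_real_derivative L * \<mu> s) (at s within {0..T})" for s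
    unfolding \<mu>_def by (auto intro!: derivative_eq_intros)
  have "spd (\<mu> t *\<^sub>R mat 1 - P t)"
  proof (rule spd_barrier[where M = "\<lambda>s. \<mu> s *\<^sub>R mat 1 - P s"
        and M' = "\<lambda>s. (L * \<mu> s) *\<^sub>R mat 1 - riccati_rhs A G W (P s)", OF _ _ _ _ t])
    fix s assume s: "s \<in> {0..T}"
    show "((\<lambda>s. \<mu> s *\<^sub>R mat 1 - P s) has_vector_derivative
        (L * \<mu> s) *\<^sub>R mat 1 - riccati_rhs A G W (P s)) (at s within {0..T})"
      using ode s unfolding riccati_ode_def
      by (intro has_vector_derivative_diff has_vector_derivative_scaleR_const d\<mu>) blast
    show "transpose (\<mu> s *\<^sub>R mat 1 - P s) = \<mu> s *\<^sub>R mat 1 - P s"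
      by (simp add: transpose_diff transpose_scalar sym[OF s])
    fix x :: "real^'n" assume x: "norm x = 1" and ker: "(\<mu> s *\<^sub>R mat 1 - P s) *v x = 0"
    have "1 * 1 \<le> \<mu> s"
      unfolding \<mu>_def using M_nonneg s L0 by (intro mult_mono) auto
    then have \<mu>1: "1 \<le> \<mu> s" by simp
    have eig: "P s *v x = \<mu> s *\<^sub>R x"
      using ker by (simp add: matrix_vector_mult_diff_rdistrib scaleR_mat_vector)
    have "\<bar>x \<bullet> (A *v x)\<bar> \<le> M" "\<bar>x \<bullet> (W *v x)\<bar> \<le> M"
      using abs_inner_matrix_le[of x A] abs_inner_matrix_le[of x W] M x by auto
    then have "\<mu> s * (x \<bullet> (A *v x)) \<le> \<mu> s * M" "x \<bullet> (W *v x) \<le> M" "0 \<le> (\<mu> s)\<^sup>2 * (x \<bullet> (G *v x))"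
      using \<mu>1 pG by (auto intro!: mult_left_mono mult_nonneg_nonneg)
    moreover have "M \<le> \<mu> s * M" using \<mu>1 M_nonneg mult_right_mono[of 1 "\<mu> s" M] by simp
    ultimately have "x \<bullet> (riccati_rhs A G W (P s) *v x) \<le> 3 * M * \<mu> s"
      unfolding riccati_form_at_eigenvector[OF sym[OF s] eig]
      by (simp add: algebra_simps)
    moreover have "x \<bullet> x = 1" using x by (simp add: power2_norm_eq_inner[symmetric])
    ultimately show "0 < x \<bullet> (((L * \<mu> s) *\<^sub>R mat 1 - riccati_rhs A G W (P s)) *v x)"
      using \<mu>1 by (simp add: matrix_vector_mult_diff_rdistrib
          scaleR_mat_vector inner_diff_right L_def algebra_simps)
  next
    have "x \<bullet> ((\<mu> 0 *\<^sub>R mat 1 - P 0) *v x) > 0" if "x \<noteq> 0" for x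
    proof -
      have "x \<bullet> (P 0 *v x) \<le> norm (P 0) * (norm x)\<^sup>2"
        using abs_inner_matrix_le[of x "P 0"] by simp
      also have "\<dots> \<le> M * (norm x)\<^sup>2" using M by (intro mult_right_mono) simp_all
      also have "\<dots> < (M + 1) * (norm x)\<^sup>2" using that by (intro mult_strict_right_mono) simp_all
      finally show ?thesis
        by (simp add: \<mu>_def matrix_vector_mult_diff_rdistrib scaleR_mat_vector inner_diff_right
            power2_norm_eq_inner)
    qed
    then show "spd (\<mu> 0 *\<^sub>R mat 1 - P 0)"
      by (simp add: spd_def transpose_diff transpose_scalar s0)
  qed
  then have "0 \<le> x \<bullet> ((\<mu> t *\<^sub>R mat 1 - P t) *v x)"
    unfolding spd_def by (cases "x = 0") (auto intro: less_imp_le)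
  then have "x \<bullet> (P t *v x) \<le> \<mu> t * (norm x)\<^sup>2"
    by (simp add: matrix_vector_mult_diff_rdistrib scaleR_mat_vector inner_diff_right
        power2_norm_eq_inner)
  moreover have "\<mu> t \<le> (M + 1) * exp (L * T)"
    unfolding \<mu>_def using M_nonneg L0 t by (intro mult_left_mono) auto
  ultimately show ?thesis
    using mult_right_mono[of "\<mu> t" "(M + 1) * exp (L * T)" "(norm x)\<^sup>2"] by (simp add: L_def)
qed

lemma riccati_norm_bound:
  assumes t: "t \<in> {0..T}"
  shows "norm (P t) \<le> real CARD('n) * real CARD('n) * ((M + 1) * exp ((3 * M + 1) * T))"
proof (rule norm_le_of_quadratic_form_le[OF sym[OF t] _ riccati_upper_bound[OF t]])
  fix x :: "real^'n"
  have "0 \<le> a / 2 * exp (- (3 * M + 1) * T) * (norm x)\<^sup>2"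
    using a by (intro mult_nonneg_nonneg) simp_all
  then show "0 \<le> x \<bullet> (P t *v x)"
    using riccati_lower_bound[OF t, of x] by linarith
qed

end

section \<open>The observer equation\<close>

text \<open>The observer equation for the gain \<open>H\<close> in Caratheodory form, with gauge integrals. The weak
  derivative \<open>g\<close> and the exceptional null set \<open>N\<close> are arguments, so that two solutions can be
  subtracted outside the union of their null sets.\<close>

definition observer_ode ::
  "real \<Rightarrow> real^'n^'r \<Rightarrow> (real \<Rightarrow> real^'r) \<Rightarrow> real^'n^'n \<Rightarrow> (real \<Rightarrow> real^'r^'n) \<Rightarrow>
   (real \<Rightarrow> real^'n) \<Rightarrow> (real \<Rightarrow> real^'n) \<Rightarrow> real set \<Rightarrow> bool" where
  "observer_ode T C y A H x g N \<longleftrightarrow>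
     g integrable_on {0..T} \<and> negligible N \<and>
     (\<forall>t\<in>{0..T}. x t = x 0 + integral {0..t} g) \<and>
     (\<forall>s\<in>{0..T} - N. g s = A *v x s + H s *v (y s - C *v x s))"

lemma observer_odeD:
  assumes "observer_ode T C y A H x g N"
  shows "g integrable_on {0..T}" and "negligible N"
    and "t \<in> {0..T} \<Longrightarrow> x t = x 0 + integral {0..t} g"
    and "s \<in> {0..T} - N \<Longrightarrow> g s = A *v x s + H s *v (y s - C *v x s)"
  using assms by (auto simp only: observer_ode_def)

text \<open>Since the interval is bounded, \<open>|v| \<le> 1 + |v|\<^sup>2\<close> suffices.\<close>

lemma L2_on_set_integrable:
  fixes f :: "real \<Rightarrow> 'v::euclidean_space"
  assumes "L2_on T f"
  shows "set_integrable lebesgue {0..T} f"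
proof -
  have meas: "set_borel_measurable lebesgue {0..T} f"
    and sq: "set_integrable lebesgue {0..T} (\<lambda>t. (norm (f t))\<^sup>2)"
    using assms by (auto simp: L2_on_def)
  have one: "set_integrable lebesgue {0..T} (\<lambda>_. 1 :: real)"
    by (rule absolutely_integrable_continuous_real) (rule continuous_on_const)
  have le: "norm v \<le> 1 + (norm v)\<^sup>2" for v :: 'v
    using zero_le_power2[of "norm v - 1/2"] by (simp add: power2_eq_square algebra_simps)
  have "set_integrable lebesgue {0..T} (\<lambda>t. 1 + (norm (f t))\<^sup>2)"
    by (rule set_integral_add(1)[OF one sq])
  then have int: "integrable lebesgue (\<lambda>t. indicator {0..T} t *\<^sub>R (1 + (norm (f t))\<^sup>2))"
    unfolding set_integrable_def .
  have "norm (indicator {0..T} t *\<^sub>R f t) \<le> norm (indicator {0..T} t *\<^sub>R (1 + (norm (f t))\<^sup>2))" for t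
    by (cases "t \<in> {0..T}") (simp_all add: le del: atLeastAtMost_iff)
  then show ?thesis
    using Bochner_Integration.integrable_bound[OF int] meas
    unfolding set_integrable_def set_borel_measurable_def by blast
qed

lemma observer_solution_imp_ode:
  assumes "observer_solution T C y x0 (A, \<Gamma>, R, Q) P x"
  obtains g N where "observer_ode T C y A (\<lambda>s. P s ** transpose C ** matrix_inv Q) x g N"
    and "x 0 = x0"
proof -
  obtain g where x0: "x 0 = x0" and g: "H1_deriv T x g"
    and ae: "AE t in lebesgue. t \<in> {0..T} \<longrightarrow>
           g t = A *v x t + (P t ** transpose C ** matrix_inv Q) *v (y t - C *v x t)"
    using assms by auto
  have gi: "set_integrable lebesgue {0..T} g"
    using g L2_on_set_integrable unfolding H1_deriv_def by blast
  have "integral {0..t} g = set_lebesgue_integral lebesgue {0..t} g" if "t \<in> {0..T}" for t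
    using that
    by (intro set_lebesgue_integral_eq_integral(2)[symmetric] set_integrable_subset[OF gi]) auto
  then have x: "\<forall>t\<in>{0..T}. x t = x 0 + integral {0..t} g"
    using g unfolding H1_deriv_def by metis
  from ae obtain N where N: "N \<in> null_sets lebesgue"
    and sub: "{t \<in> space lebesgue. \<not> (t \<in> {0..T} \<longrightarrow>
           g t = A *v x t + (P t ** transpose C ** matrix_inv Q) *v (y t - C *v x t))} \<subseteq> N"
    unfolding eventually_ae_filter by blast
  have "observer_ode T C y A (\<lambda>s. P s ** transpose C ** matrix_inv Q) x g N"
    unfolding observer_ode_def
  proof (intro conjI ballI)
    show "g integrable_on {0..T}" using set_lebesgue_integral_eq_integral(1)[OF gi] .
    show "negligible N" using N by (simp add: negligible_iff_null_sets)
    fix s assume s: "s \<in> {0..T} - N"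
    show "g s = A *v x s + (P s ** transpose C ** matrix_inv Q) *v (y s - C *v x s)"
    proof (rule ccontr)
      assume "\<not> ?thesis"
      then have "s \<in> N" using sub s by auto
      then show False using s by simp
    qed
  qed (use x in blast)
  then show ?thesis using that x0 by blast
qed

context
  fixes T M :: real and y :: "real \<Rightarrow> real^'r" and C :: "real^'n^'r"
  assumes T: "0 \<le> T" and M0: "0 < M" and C: "norm C \<le> M"
    and y: "(\<lambda>s. norm (y s)) integrable_on {0..T}"
begin

text \<open>An a priori bound on the state. It is needed because a perturbation of \<open>A\<close> or of the gain acts
  on the difference of two states through the state itself.\<close>

lemma observer_bound:
  assumes ode: "observer_ode T C y A H x g N"
    and A: "norm A \<le> M" and H: "\<And>s. s \<in> {0..T} \<Longrightarrow> norm (H s) \<le> M"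
    and t: "t \<in> {0..T}"
  shows "norm (x t) \<le> (norm (x 0) + M * integral {0..T} (\<lambda>s. norm (y s))) * exp (2 * (M + M * M) * T)"
proof -
  have gb: "norm (g s) \<le> (M + M * M) * norm (x s) + M * norm (y s)" if s: "s \<in> {0..T} - N" for s
  proof -
    have "norm (g s) = norm (A *v x s + H s *v (y s - C *v x s))"
      using observer_odeD(4)[OF ode s] by (simp only:)
    also have "\<dots> \<le> norm A * norm (x s) + norm (H s) * (norm (y s) + norm C * norm (x s))"
      by (intro norm_triangle_le add_mono order_trans[OF norm_matrix_vector_mult_le] mult_left_mono
          order_trans[OF norm_triangle_ineq4]) simp_all
    also have "\<dots> \<le> M * norm (x s) + M * (norm (y s) + M * norm (x s))"
      using A C H[of s] s M0 by (intro add_mono mult_mono) auto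
    finally show ?thesis by (simp add: algebra_simps)
  qed
  have "norm (x t) \<le> (norm (x 0) + integral {0..T} (\<lambda>s. M * norm (y s))) * exp (2 * (M + M * M) * T)"
  proof (rule gronwall_weak_derivative[OF _ _ _ _ _ _ gb t])
    show "(\<lambda>s. M * norm (y s)) integrable_on {0..T}"
      using integrable_cmul[OF y, of M] by simp
    show "g integrable_on {0..T}" "negligible N" by (rule observer_odeD[OF ode])+
    show "x s = x 0 + integral {0..s} g" if "s \<in> {0..T}" for s
      using observer_odeD(3)[OF ode that] .
  qed (use M0 in \<open>simp_all add: add_pos_pos\<close>)
  then show ?thesis by simp
qed

text \<open>The difference \<open>e\<close> of two states satisfies the first system's homogeneous equation
  \<open>e' = (A\<^sub>1 - H\<^sub>1 C) e\<close> up to the source \<open>(A\<^sub>1 - A\<^sub>2) x\<^sub>2 + (H\<^sub>1 - H\<^sub>2) (y - C x\<^sub>2)\<close>, whose integral is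
  of order \<open>\<delta>\<close>.\<close>

lemma observer_lipschitz:
  assumes ode1: "observer_ode T C y A1 H1 x1 g1 N1" and ode2: "observer_ode T C y A2 H2 x2 g2 N2"
    and init: "x1 0 = x2 0"
    and A1: "norm A1 \<le> M" and H1: "\<And>s. s \<in> {0..T} \<Longrightarrow> norm (H1 s) \<le> M"
    and dA: "norm (A1 - A2) \<le> \<delta>" and dH: "\<And>s. s \<in> {0..T} \<Longrightarrow> norm (H1 s - H2 s) \<le> \<delta>"
    and X: "\<And>s. s \<in> {0..T} \<Longrightarrow> norm (x2 s) \<le> X"
    and t: "t \<in> {0..T}"
  shows "norm (x1 t - x2 t) \<le>
    (T * (X + M * X) + integral {0..T} (\<lambda>s. norm (y s))) * exp (2 * (M + M * M) * T) * \<delta>"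
proof -
  have \<delta>0: "0 \<le> \<delta>" using dA norm_ge_zero order_trans by blast
  have X0: "0 \<le> X" using X[OF t] norm_ge_zero order_trans by blast
  let ?e = "\<lambda>s. x1 s - x2 s" and ?g = "\<lambda>s. g1 s - g2 s"
  let ?h = "\<lambda>s. \<delta> * (X + M * X) + \<delta> * norm (y s)"
  have gb: "norm (?g s) \<le> (M + M * M) * norm (?e s) + ?h s" if s: "s \<in> {0..T} - (N1 \<union> N2)" for s
  proof -
    have "g1 s = A1 *v x1 s + H1 s *v (y s - C *v x1 s)"
      "g2 s = A2 *v x2 s + H2 s *v (y s - C *v x2 s)"
      by (rule observer_odeD(4)[OF ode1] observer_odeD(4)[OF ode2], use s in blast)+
    then have eq: "?g s = (A1 *v ?e s - H1 s *v (C *v ?e s))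
        + ((A1 - A2) *v x2 s + (H1 s - H2 s) *v (y s - C *v x2 s))"
      by (simp add: algebra_simps)
    have "norm (?g s) \<le> (norm A1 * norm (?e s) + norm (H1 s) * (norm C * norm (?e s)))
        + (norm (A1 - A2) * norm (x2 s) + norm (H1 s - H2 s) * (norm (y s) + norm C * norm (x2 s)))"
    proof -
      define e where "e = ?e s"
      define v where "v = y s - C *v x2 s"
      have Ce: "norm (C *v e) \<le> norm C * norm e" by (rule norm_matrix_vector_mult_le)
      have v: "norm v \<le> norm (y s) + norm C * norm (x2 s)"
        using norm_triangle_ineq4[of "y s" "C *v x2 s"] norm_matrix_vector_mult_le[of C "x2 s"]
        unfolding v_def by linarith
      have "norm (H1 s *v (C *v e)) \<le> norm (H1 s) * (norm C * norm e)"
        "norm ((H1 s - H2 s) *v v) \<le> norm (H1 s - H2 s) * (norm (y s) + norm C * norm (x2 s))"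
        using Ce v by (auto intro!: order_trans[OF norm_matrix_vector_mult_le] mult_left_mono)
      then show ?thesis
        using norm_triangle_ineq[of "A1 *v e - H1 s *v (C *v e)" "(A1 - A2) *v x2 s + (H1 s - H2 s) *v v"]
          norm_triangle_ineq4[of "A1 *v e" "H1 s *v (C *v e)"]
          norm_triangle_ineq[of "(A1 - A2) *v x2 s" "(H1 s - H2 s) *v v"]
          norm_matrix_vector_mult_le[of A1 e] norm_matrix_vector_mult_le[of "A1 - A2" "x2 s"]
        unfolding eq e_def[symmetric] v_def[symmetric] by linarith
    qed
    also have "\<dots> \<le> (M * norm (?e s) + M * (M * norm (?e s)))
        + (\<delta> * X + \<delta> * (norm (y s) + M * X))"
      using A1 C H1[of s] dA dH[of s] X[of s] s M0 \<delta>0 X0 by (intro add_mono mult_mono) auto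
    finally show ?thesis by (simp add: algebra_simps)
  qed
  have gi: "g1 integrable_on {0..T}" "g2 integrable_on {0..T}"
    and N: "negligible N1" "negligible N2"
    by (rule observer_odeD[OF ode1] observer_odeD[OF ode2])+
  have yi: "(\<lambda>s. \<delta> * norm (y s)) integrable_on {0..T}" using integrable_cmul[OF y, of \<delta>] by simp
  have "norm (?e t) \<le> (norm (?e 0) + integral {0..T} ?h) * exp (2 * (M + M * M) * T)"
  proof (rule gronwall_weak_derivative[OF _ _ _ _ _ _ gb t])
    show "?h integrable_on {0..T}" by (intro integrable_add yi integrable_const_ivl)
    show "?e s = ?e 0 + integral {0..s} ?g" if s: "s \<in> {0..T}" for s
    proof -
      have sub: "{0..s} \<subseteq> {0..T}" using s by auto
      have "g1 integrable_on {0..s}" "g2 integrable_on {0..s}"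
        using gi integrable_on_subinterval[OF _ sub] by blast+
      then have "integral {0..s} ?g = integral {0..s} g1 - integral {0..s} g2"
        by (rule integral_diff)
      moreover have "x1 s = x1 0 + integral {0..s} g1" "x2 s = x2 0 + integral {0..s} g2"
        using observer_odeD(3)[OF ode1 s] observer_odeD(3)[OF ode2 s] .
      ultimately show ?thesis by (simp only: add_diff_add)
    qed
    show "?g integrable_on {0..T}" by (intro integrable_diff gi)
    show "negligible (N1 \<union> N2)" by (intro negligible_Un N)
  qed (use M0 \<delta>0 X0 in \<open>simp_all add: add_pos_pos\<close>)
  also have "integral {0..T} ?h = T * (\<delta> * (X + M * X)) + \<delta> * integral {0..T} (\<lambda>s. norm (y s))"
    using T integral_add[OF integrable_const_ivl yi, of "\<delta> * (X + M * X)"] by simp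
  finally show ?thesis by (simp add: init algebra_simps)
qed

end

section \<open>Minimizers of the aggregated value functions\<close>

text \<open>A compact sublevel set guarantees that the choice made by \<open>ARG_MIN\<close> is a minimizer.\<close>

lemma arg_min_le:
  fixes F :: "'v::euclidean_space \<Rightarrow> real"
  assumes cont: "continuous_on UNIV F" and bdd: "bounded {x. F x \<le> F p}"
  shows "F (ARG_MIN F x. True) \<le> F p"
proof -
  have "closed {x. F x \<le> F p}"
    using continuous_on_closed_Collect_le[OF cont continuous_on_const closed_UNIV] by simp
  then have "compact {x. F x \<le> F p}" using bdd compact_eq_bounded_closed by blast
  moreover have "{x. F x \<le> F p} \<noteq> {}" by blast
  ultimately obtain z where z: "F z \<le> F p" "\<And>x. F x \<le> F p \<Longrightarrow> F z \<le> F x"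
    using continuous_attains_inf[OF _ _ continuous_on_subset[OF cont subset_UNIV]]
    by (metis mem_Collect_eq)
  then have "is_arg_min F (\<lambda>_. True) z"
    unfolding is_arg_min_def by (metis le_less_trans less_le_not_le linorder_le_cases)
  then have "is_arg_min F (\<lambda>_. True) (ARG_MIN F x. True)"
    unfolding arg_min_def by (rule someI)
  then show ?thesis unfolding is_arg_min_def by (simp add: not_less)
qed

lemma continuous_on_Max_finite:
  fixes f :: "'k \<Rightarrow> 'a::topological_space \<Rightarrow> real"
  assumes "finite K" "K \<noteq> {}" "\<And>k. k \<in> K \<Longrightarrow> continuous_on S (f k)"
  shows "continuous_on S (\<lambda>x. Max ((\<lambda>k. f k x) ` K))"
  using assms
proof (induction rule: finite_ne_induct)
  case (insert k K)
  then have "(\<lambda>x. Max ((\<lambda>k. f k x) ` insert k K)) = (\<lambda>x. max (f k x) (Max ((\<lambda>k. f k x) ` K)))"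
    by (intro ext) simp
  then show ?case using insert by (auto intro: continuous_on_max)
qed simp

context
  fixes \<Sigma> :: "'k set" and V :: "'k \<Rightarrow> real \<Rightarrow> 'v::euclidean_space \<Rightarrow> real" and t :: real
  assumes fin: "finite \<Sigma>" and ne: "\<Sigma> \<noteq> {}"
    and cont: "\<And>k. k \<in> \<Sigma> \<Longrightarrow> continuous_on UNIV (V k t)"
    and bdd: "\<And>k b. k \<in> \<Sigma> \<Longrightarrow> bounded {x. V k t x \<le> b}"
begin

text \<open>Both aggregates are strictly increasing in the family of values: if all values at \<open>p\<close>
  were smaller than at the estimate, then so would be the aggregate.\<close>

lemma estimate_max_le_some_value: "\<exists>k\<in>\<Sigma>. V k t (estimate_max \<Sigma> V t) \<le> V k t p"
proof -
  let ?F = "\<lambda>x. Max ((\<lambda>k. V k t x) ` \<Sigma>)"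
  let ?z = "estimate_max \<Sigma> V t"
  have le: "V k t x \<le> ?F x" if "k \<in> \<Sigma>" for k x using fin that by simp
  obtain k0 where k0: "k0 \<in> \<Sigma>" using ne by blast
  have "bounded {x. ?F x \<le> ?F p}"
  proof (rule bounded_subset[OF bdd[OF k0, of "?F p"]], rule subsetI)
    show "x \<in> {x. V k0 t x \<le> ?F p}" if "x \<in> {x. ?F x \<le> ?F p}" for x
      using le[OF k0, of x] that by simp
  qed
  then have Fz: "?F ?z \<le> ?F p"
    unfolding estimate_max_def
    by (intro arg_min_le continuous_on_Max_finite fin ne cont)
  have "?F p \<in> (\<lambda>k. V k t p) ` \<Sigma>" using fin ne by (intro Max_in) simp_all
  then obtain k where "k \<in> \<Sigma>" "V k t p = ?F p" by auto
  with Fz le[of k ?z] show ?thesis by (intro bexI[of _ k]) simp_all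
qed

lemma estimate_exp_le_some_value:
  assumes \<theta>: "\<theta> > 0"
  shows "\<exists>k\<in>\<Sigma>. V k t (estimate_exp \<theta> \<Sigma> V t) \<le> V k t p"
proof -
  let ?E = "\<lambda>x. \<Sum>k\<in>\<Sigma>. exp (\<theta> * V k t x)"
  let ?F = "\<lambda>x. 1 / \<theta> * ln (1 / real (card \<Sigma>) * ?E x)"
  let ?z = "estimate_exp \<theta> \<Sigma> V t"
  have card: "real (card \<Sigma>) > 0" using fin ne by (simp add: card_gt_0_iff)
  have E0: "?E x > 0" for x using fin ne by (intro sum_pos) simp_all
  have FE: "?F x \<le> ?F x' \<longleftrightarrow> ?E x \<le> ?E x'" for x x'
    using \<theta> card E0[of x] E0[of x'] by (simp add: divide_le_cancel)
  obtain k0 where k0: "k0 \<in> \<Sigma>" using ne by blast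
  have "bounded {x. ?F x \<le> ?F p}"
  proof (rule bounded_subset[OF bdd[OF k0, of "ln (?E p) / \<theta>"]], rule subsetI)
    fix x assume "x \<in> {x. ?F x \<le> ?F p}"
    then have "?E x \<le> ?E p" using FE by simp
    moreover have "exp (\<theta> * V k0 t x) \<le> ?E x"
      using fin k0 by (intro member_le_sum) simp_all
    ultimately have "\<theta> * V k0 t x \<le> ln (?E p)" using E0[of p] by (subst ln_ge_iff) linarith+
    then show "x \<in> {x. V k0 t x \<le> ln (?E p) / \<theta>}" using \<theta> by (simp add: field_simps)
  qed
  moreover have "continuous_on UNIV ?F"
    using E0 card cont by (intro continuous_intros) (auto simp: less_imp_neq[symmetric])
  ultimately have "?F ?z \<le> ?F p"
    unfolding estimate_exp_def by (intro arg_min_le)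
  then have Ez: "?E ?z \<le> ?E p" using FE by blast
  show ?thesis
  proof (rule ccontr)
    assume "\<not> ?thesis"
    then have "?E p < ?E ?z" using \<theta> fin ne by (intro sum_strict_mono) (auto simp: not_le)
    then show False using Ez by simp
  qed
qed

end

lemma bounded_quadratic_sublevel:
  fixes P :: "real^'n^'n"
  assumes p: "p > 0" and lo: "\<And>x. p * (norm x)\<^sup>2 \<le> x \<bullet> (P *v x)"
  shows "bounded {x. wnorm_sq P (x - c) + r \<le> b}"
proof (rule boundedI)
  fix x assume "x \<in> {x. wnorm_sq P (x - c) + r \<le> b}"
  then have "p * (norm (x - c))\<^sup>2 \<le> b - r"
    using lo[of "x - c"] by (simp add: wnorm_sq_def)
  then have "(norm (x - c))\<^sup>2 \<le> (b - r) / p" using p by (simp add: field_simps)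
  then have "norm (x - c) \<le> sqrt ((b - r) / p)" by (rule real_le_rsqrt)
  then show "norm x \<le> norm c + sqrt ((b - r) / p)"
    using norm_triangle_ineq[of c "x - c"] by simp
qed

text \<open>With \<open>u = z - p\<close> and \<open>e = c - p\<close>, the hypothesis reads \<open>|u - e|\<^sub>P \<le> |e|\<^sub>P\<close>; expanding the
  square gives \<open>|u|\<^sub>P\<^sup>2 \<le> 2 \<langle>u, e\<rangle>\<^sub>P\<close>.\<close>

lemma distance_from_value_comparison:
  fixes P :: "real^'n^'n"
  assumes sym: "transpose P = P" and p: "l > 0"
    and lo: "\<And>x. l * (norm x)\<^sup>2 \<le> x \<bullet> (P *v x)" and up: "norm P \<le> b"
    and le: "wnorm_sq P (z - c) + r \<le> wnorm_sq P (p - c) + r"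
  shows "norm (z - p) \<le> 2 * b / l * norm (c - p)"
proof -
  define u e where "u = z - p" and "e = c - p"
  have "(u - e) \<bullet> (P *v (u - e)) \<le> (- e) \<bullet> (P *v (- e))"
    using le by (simp add: wnorm_sq_def u_def e_def)
  then have "u \<bullet> (P *v u) \<le> 2 * (u \<bullet> (P *v e))"
    using inner_symmetric_matrix[OF sym, of e u]
    by (simp add: inner_diff_left inner_diff_right inner_commute matrix_vector_mult_diff_distrib
        bounded_bilinear.minus_right[OF bounded_bilinear_matrix_vector_mult])
  also have "u \<bullet> (P *v e) \<le> norm u * (b * norm e)"
    using norm_matrix_vector_mult_le[of P e] mult_right_mono[OF up, of "norm e"]
    by (intro order_trans[OF norm_cauchy_schwarz] mult_left_mono) auto
  finally have "norm u * (l * norm u) \<le> norm u * (2 * b * norm e)"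
    using lo[of u] by (simp add: power2_eq_square mult_ac)
  then have "l * norm u \<le> 2 * b * norm e"
  proof (cases "u = 0")
    case True
    have "0 \<le> b" using up norm_ge_zero order_trans by blast
    then show ?thesis using True by simp
  qed simp
  then show ?thesis using p by (simp add: u_def e_def field_simps)
qed

section \<open>Uniform estimates over a compact class of systems\<close>

definition info_matrix :: "real^'n^'r \<Rightarrow> real^'r^'r \<Rightarrow> real^'n^'n" where
  "info_matrix C Q = transpose C ** matrix_inv Q ** C"

definition noise_matrix :: "real^'m^'n \<Rightarrow> real^'m^'m \<Rightarrow> real^'n^'n" where
  "noise_matrix B R = B ** R ** transpose B"

lemma inner_transpose_vector:
  fixes B :: "real^'m^'n"
  shows "x \<bullet> (B *v y) = (transpose B *v x) \<bullet> y"
  using dot_lmul_matrix[of x B y] by simp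

lemma noise_matrix_psd:
  assumes "spd R"
  shows "transpose (noise_matrix B R) = noise_matrix B R"
    and "0 \<le> x \<bullet> (noise_matrix B R *v x)"
proof -
  show "transpose (noise_matrix B R) = noise_matrix B R"
    using assms by (simp add: noise_matrix_def spd_def matrix_transpose_mul matrix_mul_assoc)
  have "x \<bullet> (noise_matrix B R *v x) = (transpose B *v x) \<bullet> (R *v (transpose B *v x))"
    unfolding noise_matrix_def matrix_vector_mul_assoc[symmetric] by (rule inner_transpose_vector)
  also have "\<dots> \<ge> 0"
    using assms unfolding spd_def by (metis inner_zero_left less_eq_real_def)
  finally show "0 \<le> x \<bullet> (noise_matrix B R *v x)" .
qed

lemma info_matrix_psd:
  assumes "spd Q"
  shows "transpose (info_matrix C Q) = info_matrix C Q"
    and "0 \<le> x \<bullet> (info_matrix C Q *v x)"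
proof -
  have inv: "invertible Q" and sym: "transpose Q = Q"
    using assms spd_invertible by (auto simp: spd_def)
  show "transpose (info_matrix C Q) = info_matrix C Q"
    by (simp add: info_matrix_def matrix_transpose_mul matrix_mul_assoc transpose_matrix_inv[OF inv sym])
  let ?w = "matrix_inv Q *v (C *v x)"
  have "x \<bullet> (info_matrix C Q *v x) = (C *v x) \<bullet> ?w"
    unfolding info_matrix_def matrix_vector_mul_assoc[symmetric]
    by (subst inner_transpose_vector) (simp only: transpose_transpose)
  also have "\<dots> = ?w \<bullet> (Q *v ?w)"
    using matrix_inv_right_vector[OF inv, of "C *v x"] by (simp add: inner_commute)
  also have "\<dots> \<ge> 0"
    using assms unfolding spd_def by (metis inner_zero_left less_eq_real_def)
  finally show "0 \<le> x \<bullet> (info_matrix C Q *v x)" .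
qed

lemma riccati_solution_imp_ode:
  assumes "riccati_solution T B C (A, \<Gamma>, R, Q) P"
  shows "riccati_ode T A (info_matrix C Q) (noise_matrix B R) P" and "P 0 = \<Gamma>"
  using assms
  by (auto simp: riccati_ode_def riccati_rhs_def info_matrix_def noise_matrix_def matrix_mul_assoc)

lemma norm_sandwich_le:
  fixes X :: "real^'m^'n" and Y :: "real^'k^'m" and Z :: "real^'l^'k"
  shows "norm (X ** Y ** Z) \<le> norm X * norm Y * norm Z"
  by (intro order_trans[OF norm_matrix_mult_le] mult_right_mono norm_matrix_mult_le) simp

lemma norm_info_matrix_diff_le:
  "norm (info_matrix C Q1 - info_matrix C Q2)
    \<le> norm C * norm (matrix_inv Q1 - matrix_inv Q2) * norm C"
  using norm_sandwich_le[of "transpose C" "matrix_inv Q1 - matrix_inv Q2" C]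
  by (simp add: info_matrix_def matrix_mult_diff_left matrix_mult_diff_right norm_transpose)

lemma norm_noise_matrix_diff_le:
  "norm (noise_matrix B R1 - noise_matrix B R2) \<le> norm B * norm (R1 - R2) * norm B"
  using norm_sandwich_le[of B "R1 - R2" "transpose B"]
  by (simp add: noise_matrix_def matrix_mult_diff_left matrix_mult_diff_right norm_transpose)

abbreviation sysdist ::
  "('n::finite, 'm::finite, 'r::finite) system \<Rightarrow> ('n, 'm, 'r) system \<Rightarrow> real" where
  "sysdist S1 S2 \<equiv> norm1 norm norm norm (S1 - S2)"

lemma sysdist_nonneg: "0 \<le> sysdist S1 S2"
  by (cases S1 rule: prod_cases4; cases S2 rule: prod_cases4) simp

context
  fixes T :: real and B :: "real^'m^'n" and C :: "real^'n^'r"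
    and K :: "('n::finite, 'm::finite, 'r::finite) system set"
  assumes T: "0 \<le> T" and K: "compact K" and adm: "\<forall>S\<in>K. admissible S"
begin

text \<open>All bounds on the data of a system in \<open>K\<close>, packed into a lower bound \<open>a\<close> for the initial forms
  and one upper bound \<open>M\<close>. The weights \<open>Q\<close> enter the dynamics through their inverses, which are
  bounded because the forms of the \<open>Q\<close> in \<open>K\<close> are uniformly positive.\<close>

lemma class_bounds:
  obtains M a where "0 < M" "0 < a" "a \<le> 1"
    "\<And>A \<Gamma> R Q. (A, \<Gamma>, R, Q) \<in> K \<Longrightarrow> spd \<Gamma> \<and> spd R \<and> spd Q \<and>
      norm A \<le> M \<and> norm \<Gamma> \<le> M \<and> norm (matrix_inv Q) \<le> M \<and>
      norm (info_matrix C Q) \<le> M \<and> norm (noise_matrix B R) \<le> M \<and>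
      (\<forall>x. a * (norm x)\<^sup>2 \<le> x \<bullet> (\<Gamma> *v x))"
proof -
  obtain m where m: "\<And>S. S \<in> K \<Longrightarrow> norm S \<le> m"
    using compact_imp_bounded[OF K] unfolding bounded_iff by blast
  have mcomp: "norm A \<le> m \<and> norm \<Gamma> \<le> m \<and> norm R \<le> m" if "(A, \<Gamma>, R, Q) \<in> K" for A \<Gamma> R Q
    using m[OF that] norm_fst_le[of A "(\<Gamma>, R, Q)"] norm_snd_le[of "(\<Gamma>, R, Q)" A]
      norm_fst_le[of \<Gamma> "(R, Q)"] norm_snd_le[of "(R, Q)" \<Gamma>] norm_fst_le[of R Q]
    by linarith
  have spd: "spd \<Gamma> \<and> spd R \<and> spd Q" if "(A, \<Gamma>, R, Q) \<in> K" for A \<Gamma> R Q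
    using adm that by (metis admissible.simps)
  have c\<Gamma>: "compact ((\<lambda>S. fst (snd S)) ` K)" and cQ: "compact ((\<lambda>S. snd (snd (snd S))) ` K)"
    by (intro compact_continuous_image continuous_intros K)+
  obtain a where a: "0 < a" "a \<le> 1"
    "\<And>M x. M \<in> (\<lambda>S. fst (snd S)) ` K \<Longrightarrow> a * (norm x)\<^sup>2 \<le> x \<bullet> (M *v x)"
    by (rule compact_spd_uniform_bound[OF c\<Gamma>]) (use spd in force)+
  obtain q where q: "0 < q"
    "\<And>M x. M \<in> (\<lambda>S. snd (snd (snd S))) ` K \<Longrightarrow> q * (norm x)\<^sup>2 \<le> x \<bullet> (M *v x)"
    by (rule compact_spd_uniform_bound[OF cQ]) (use spd in force)+
  define n where "n = real CARD('r) * real CARD('r) / q"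
  have n0: "0 \<le> n" using q(1) by (simp add: n_def)
  have nQ: "norm (matrix_inv Q) \<le> n" if "(A, \<Gamma>, R, Q) \<in> K" for A \<Gamma> R Q
    unfolding n_def
  proof (rule norm_matrix_inv_le[OF _ q(1)])
    show "transpose Q = Q" using spd[OF that] by (simp add: spd_def)
    show "q * (norm x)\<^sup>2 \<le> x \<bullet> (Q *v x)" for x
      by (rule q(2), rule image_eqI[OF _ that]) simp
  qed
  define M where "M = \<bar>m\<bar> + n + norm C * n * norm C + norm B * \<bar>m\<bar> * norm B + 1"
  have nn: "0 \<le> norm C * n * norm C" "0 \<le> norm B * \<bar>m\<bar> * norm B" using n0 by simp_all
  show ?thesis
  proof (rule that[of M a])
    show "0 < M" using n0 nn unfolding M_def by linarith
    fix A \<Gamma> R Q assume S: "(A, \<Gamma>, R, Q) \<in> K"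
    have "norm (info_matrix C Q) \<le> norm C * norm (matrix_inv Q) * norm C"
      unfolding info_matrix_def using norm_sandwich_le[of "transpose C" "matrix_inv Q" C]
      by (simp add: norm_transpose)
    also have "\<dots> \<le> norm C * n * norm C"
      by (intro mult_mono nQ[OF S]) (simp_all add: n0)
    finally have G: "norm (info_matrix C Q) \<le> M"
      using n0 nn unfolding M_def by linarith
    have "norm (noise_matrix B R) \<le> norm B * norm R * norm B"
      unfolding noise_matrix_def using norm_sandwich_le[of B R "transpose B"]
      by (simp add: norm_transpose)
    also have "\<dots> \<le> norm B * \<bar>m\<bar> * norm B"
    proof -
      have "norm R \<le> \<bar>m\<bar>" using mcomp[OF S] by linarith
      then show ?thesis by (intro mult_mono) simp_all
    qed
    finally have W: "norm (noise_matrix B R) \<le> M"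
      using n0 nn unfolding M_def by linarith
    have \<Gamma>: "a * (norm x)\<^sup>2 \<le> x \<bullet> (\<Gamma> *v x)" for x
      by (rule a(3), rule image_eqI[OF _ S]) simp
    have "norm A \<le> M" "norm \<Gamma> \<le> M" "norm (matrix_inv Q) \<le> M"
      using mcomp[OF S] nQ[OF S] n0 nn unfolding M_def by linarith+
    then show "spd \<Gamma> \<and> spd R \<and> spd Q \<and>
      norm A \<le> M \<and> norm \<Gamma> \<le> M \<and> norm (matrix_inv Q) \<le> M \<and>
      norm (info_matrix C Q) \<le> M \<and> norm (noise_matrix B R) \<le> M \<and>
      (\<forall>x. a * (norm x)\<^sup>2 \<le> x \<bullet> (\<Gamma> *v x))"
      using spd[OF S] G W \<Gamma> by simp
  qed (use a in simp_all)
qed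

lemma riccati_class_bounds:
  obtains \<alpha> \<beta> where "0 < \<alpha>" "0 < \<beta>"
    "\<And>S P t. S \<in> K \<Longrightarrow> riccati_solution T B C S P \<Longrightarrow> t \<in> {0..T} \<Longrightarrow>
      transpose (P t) = P t \<and> norm (P t) \<le> \<beta> \<and> (\<forall>x. \<alpha> * (norm x)\<^sup>2 \<le> x \<bullet> (P t *v x))"
proof -
  obtain M a where M0: "0 < M" and a: "0 < a" "a \<le> 1"
    and cb: "\<And>A \<Gamma> R Q. (A, \<Gamma>, R, Q) \<in> K \<Longrightarrow> spd \<Gamma> \<and> spd R \<and> spd Q \<and>
      norm A \<le> M \<and> norm \<Gamma> \<le> M \<and> norm (matrix_inv Q) \<le> M \<and>
      norm (info_matrix C Q) \<le> M \<and> norm (noise_matrix B R) \<le> M \<and>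
      (\<forall>x. a * (norm x)\<^sup>2 \<le> x \<bullet> (\<Gamma> *v x))"
    by (rule class_bounds) blast
  show ?thesis
  proof (rule that)
    show "0 < a / 2 * exp (- (3 * M + 1) * T)" using a by simp
    show "0 < real CARD('n) * real CARD('n) * ((M + 1) * exp ((3 * M + 1) * T))"
      using M0 by simp
    fix S P t assume S: "S \<in> K" and sol: "riccati_solution T B C S P" and t: "t \<in> {0..T}"
    obtain A \<Gamma> R Q where S_eq: "S = (A, \<Gamma>, R, Q)" by (cases S rule: prod_cases4)
    note b = cb[OF S[unfolded S_eq]]
    have ode: "riccati_ode T A (info_matrix C Q) (noise_matrix B R) P" and P0: "P 0 = \<Gamma>"
      using riccati_solution_imp_ode sol unfolding S_eq by blast+
    have G: "transpose (info_matrix C Q) = info_matrix C Q"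
      "\<And>x. 0 \<le> x \<bullet> (info_matrix C Q *v x)"
      using info_matrix_psd b by blast+
    have W: "transpose (noise_matrix B R) = noise_matrix B R"
      "\<And>x. 0 \<le> x \<bullet> (noise_matrix B R *v x)"
      using noise_matrix_psd b by blast+
    have s0: "transpose (P 0) = P 0" using b unfolding P0 spd_def by blast
    have bnd: "norm A \<le> M" "norm (info_matrix C Q) \<le> M" "norm (noise_matrix B R) \<le> M"
      "norm (P 0) \<le> M" and lo: "\<And>x. a * (norm x)\<^sup>2 \<le> x \<bullet> (P 0 *v x)"
      using b unfolding P0 by blast+
    show "transpose (P t) = P t \<and>
        norm (P t) \<le> real CARD('n) * real CARD('n) * ((M + 1) * exp ((3 * M + 1) * T)) \<and>
        (\<forall>x. a / 2 * exp (- (3 * M + 1) * T) * (norm x)\<^sup>2 \<le> x \<bullet> (P t *v x))"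
      using riccati_symmetric[OF ode G(1) W(1) s0 t]
        riccati_norm_bound[OF ode G(1) W(1) s0 G(2) W(2) bnd a lo t]
        riccati_lower_bound[OF ode G(1) W(1) s0 G(2) W(2) bnd a lo t]
      by blast
  qed
qed

lemma riccati_class_lipschitz:
  obtains l where "0 \<le> l"
    "\<And>S1 S2 P1 P2 t. S1 \<in> K \<Longrightarrow> S2 \<in> K \<Longrightarrow> riccati_solution T B C S1 P1 \<Longrightarrow>
      riccati_solution T B C S2 P2 \<Longrightarrow> t \<in> {0..T} \<Longrightarrow>
      norm (P1 t - P2 t) \<le> l * sysdist S1 S2"
proof -
  obtain M a where M0: "0 < M"
    and cb: "\<And>A \<Gamma> R Q. (A, \<Gamma>, R, Q) \<in> K \<Longrightarrow> spd \<Gamma> \<and> spd R \<and> spd Q \<and>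
      norm A \<le> M \<and> norm \<Gamma> \<le> M \<and> norm (matrix_inv Q) \<le> M \<and>
      norm (info_matrix C Q) \<le> M \<and> norm (noise_matrix B R) \<le> M \<and>
      (\<forall>x. a * (norm x)\<^sup>2 \<le> x \<bullet> (\<Gamma> *v x))"
    by (rule class_bounds) blast
  obtain \<alpha> \<beta> where \<beta>0: "0 < \<beta>"
    and rb: "\<And>S P t. S \<in> K \<Longrightarrow> riccati_solution T B C S P \<Longrightarrow> t \<in> {0..T} \<Longrightarrow>
      transpose (P t) = P t \<and> norm (P t) \<le> \<beta> \<and> (\<forall>x. \<alpha> * (norm x)\<^sup>2 \<le> x \<bullet> (P t *v x))"
    by (rule riccati_class_bounds) blast
  \<comment> \<open>One bound for both data and solutions.\<close>
  define N where "N = M + \<beta>"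
  define c where "c = riccati_lipschitz_const T N"
  define k where "k = 1 + (norm C * M)\<^sup>2 + (norm B)\<^sup>2"
  have N0: "0 < N" using M0 \<beta>0 by (simp add: N_def)
  have c0: "0 \<le> c" unfolding c_def riccati_lipschitz_const_def using T N0 by simp
  have k: "1 \<le> k" "(norm C * M)\<^sup>2 \<le> k" "(norm B)\<^sup>2 \<le> k" by (simp_all add: k_def)
  show ?thesis
  proof (rule that)
    show "0 \<le> c * k" using c0 k by simp
    fix S1 S2 P1 P2 t
    assume S: "S1 \<in> K" "S2 \<in> K" and t: "t \<in> {0..T}"
      and sol: "riccati_solution T B C S1 P1" "riccati_solution T B C S2 P2"
    obtain A1 \<Gamma>1 R1 Q1 where S1: "S1 = (A1, \<Gamma>1, R1, Q1)" by (cases S1 rule: prod_cases4)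
    obtain A2 \<Gamma>2 R2 Q2 where S2: "S2 = (A2, \<Gamma>2, R2, Q2)" by (cases S2 rule: prod_cases4)
    note b1 = cb[OF S(1)[unfolded S1]] and b2 = cb[OF S(2)[unfolded S2]]
    have ode: "riccati_ode T A1 (info_matrix C Q1) (noise_matrix B R1) P1"
      "riccati_ode T A2 (info_matrix C Q2) (noise_matrix B R2) P2"
      and P0: "P1 0 = \<Gamma>1" "P2 0 = \<Gamma>2"
      using riccati_solution_imp_ode sol unfolding S1 S2 by blast+
    have MN: "x \<le> M \<Longrightarrow> x \<le> N" "x \<le> \<beta> \<Longrightarrow> x \<le> N" for x
      using M0 \<beta>0 by (simp_all add: N_def)
    have main: "norm (P1 t - P2 t) \<le> c * (norm (P1 0 - P2 0) + norm (A1 - A2)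
        + norm (info_matrix C Q1 - info_matrix C Q2) + norm (noise_matrix B R1 - noise_matrix B R2))"
      unfolding c_def
    proof (rule riccati_lipschitz[OF N0 ode _ _ _ _ _ _ t])
      show "norm A1 \<le> N" "norm (info_matrix C Q1) \<le> N" by (rule MN(1), use b1 in blast)+
      show "norm A2 \<le> N" "norm (info_matrix C Q2) \<le> N" by (rule MN(1), use b2 in blast)+
      show "norm (P1 s) \<le> N" if "s \<in> {0..T}" for s
        using rb[OF S(1) sol(1) that] by (intro MN(2)) blast
      show "norm (P2 s) \<le> N" if "s \<in> {0..T}" for s
        using rb[OF S(2) sol(2) that] by (intro MN(2)) blast
    qed
    have "norm (info_matrix C Q1 - info_matrix C Q2)
        \<le> norm C * norm (matrix_inv Q1 - matrix_inv Q2) * norm C"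
      by (rule norm_info_matrix_diff_le)
    also have "\<dots> \<le> norm C * (M * norm (Q1 - Q2) * M) * norm C"
    proof -
      have inv: "invertible Q1" "invertible Q2" using b1 b2 spd_invertible by blast+
      have "norm (matrix_inv Q1) * norm (Q1 - Q2) * norm (matrix_inv Q2) \<le> M * norm (Q1 - Q2) * M"
        using b1 b2 M0 by (intro mult_mono) simp_all
      then have "norm (matrix_inv Q1 - matrix_inv Q2) \<le> M * norm (Q1 - Q2) * M"
        using norm_matrix_inv_diff_le[OF inv] by linarith
      then show ?thesis by (intro mult_left_mono mult_right_mono) simp_all
    qed
    also have "\<dots> = (norm C * M)\<^sup>2 * norm (Q1 - Q2)" by (simp add: power2_eq_square)
    also have "\<dots> \<le> k * norm (Q1 - Q2)" using k by (intro mult_right_mono) simp_all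
    finally have dG: "norm (info_matrix C Q1 - info_matrix C Q2) \<le> k * norm (Q1 - Q2)" .
    have "norm (noise_matrix B R1 - noise_matrix B R2) \<le> (norm B)\<^sup>2 * norm (R1 - R2)"
      using norm_noise_matrix_diff_le[of B R1 R2] by (simp add: power2_eq_square mult_ac)
    also have "\<dots> \<le> k * norm (R1 - R2)" using k by (intro mult_right_mono) simp_all
    finally have dW: "norm (noise_matrix B R1 - noise_matrix B R2) \<le> k * norm (R1 - R2)" .
    have d1: "norm v \<le> k * norm v" for v :: "real^'n^'n"
      using mult_right_mono[OF k(1), of "norm v"] by simp
    have "norm (P1 t - P2 t) \<le> c * (k * norm (\<Gamma>1 - \<Gamma>2) + k * norm (A1 - A2)
        + k * norm (Q1 - Q2) + k * norm (R1 - R2))"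
      by (rule order_trans[OF main], unfold P0)
        (intro mult_left_mono add_mono d1 dG dW c0)
    also have "\<dots> = c * k * sysdist S1 S2" by (simp add: S1 S2 algebra_simps)
    finally show "norm (P1 t - P2 t) \<le> c * k * sysdist S1 S2" .
  qed
qed

text \<open>The gain \<open>\<Pi> C\<^sup>T Q\<^sup>-\<^sup>1\<close> inherits boundedness and Lipschitz dependence from \<open>\<Pi>\<close> and \<open>Q\<^sup>-\<^sup>1\<close>.\<close>

lemma gain_class_estimates:
  obtains b l where "0 \<le> b" "0 \<le> l"
    "\<And>A1 \<Gamma>1 R1 Q1 P1 t. (A1, \<Gamma>1, R1, Q1) \<in> K \<Longrightarrow>
      riccati_solution T B C (A1, \<Gamma>1, R1, Q1) P1 \<Longrightarrow> t \<in> {0..T} \<Longrightarrow>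
      norm A1 \<le> b \<and> norm (P1 t ** transpose C ** matrix_inv Q1) \<le> b"
    "\<And>A1 \<Gamma>1 R1 Q1 P1 A2 \<Gamma>2 R2 Q2 P2 t.
      (A1, \<Gamma>1, R1, Q1) \<in> K \<Longrightarrow> riccati_solution T B C (A1, \<Gamma>1, R1, Q1) P1 \<Longrightarrow>
      (A2, \<Gamma>2, R2, Q2) \<in> K \<Longrightarrow> riccati_solution T B C (A2, \<Gamma>2, R2, Q2) P2 \<Longrightarrow> t \<in> {0..T} \<Longrightarrow>
      norm (P1 t ** transpose C ** matrix_inv Q1 - P2 t ** transpose C ** matrix_inv Q2)
        \<le> l * sysdist (A1, \<Gamma>1, R1, Q1) (A2, \<Gamma>2, R2, Q2)"
proof -
  obtain M a where M0: "0 < M"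
    and cb: "\<And>A \<Gamma> R Q. (A, \<Gamma>, R, Q) \<in> K \<Longrightarrow> spd \<Gamma> \<and> spd R \<and> spd Q \<and>
      norm A \<le> M \<and> norm \<Gamma> \<le> M \<and> norm (matrix_inv Q) \<le> M \<and>
      norm (info_matrix C Q) \<le> M \<and> norm (noise_matrix B R) \<le> M \<and>
      (\<forall>x. a * (norm x)\<^sup>2 \<le> x \<bullet> (\<Gamma> *v x))"
    by (rule class_bounds) blast
  obtain \<alpha> \<beta> where \<beta>0: "0 < \<beta>"
    and rb: "\<And>S P t. S \<in> K \<Longrightarrow> riccati_solution T B C S P \<Longrightarrow> t \<in> {0..T} \<Longrightarrow>
      transpose (P t) = P t \<and> norm (P t) \<le> \<beta> \<and> (\<forall>x. \<alpha> * (norm x)\<^sup>2 \<le> x \<bullet> (P t *v x))"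
    by (rule riccati_class_bounds) blast
  obtain l where l0: "0 \<le> l" and lip:
    "\<And>S1 S2 P1 P2 t. S1 \<in> K \<Longrightarrow> S2 \<in> K \<Longrightarrow> riccati_solution T B C S1 P1 \<Longrightarrow>
      riccati_solution T B C S2 P2 \<Longrightarrow> t \<in> {0..T} \<Longrightarrow>
      norm (P1 t - P2 t) \<le> l * sysdist S1 S2"
    by (rule riccati_class_lipschitz) blast
  show ?thesis
  proof (rule that)
    show "0 \<le> M + \<beta> * norm C * M" using M0 \<beta>0 by simp
    show "0 \<le> l * norm C * M + \<beta> * norm C * (M * M)" using M0 \<beta>0 l0 by simp
  next
    fix A \<Gamma> R Q P t
    assume S: "(A, \<Gamma>, R, Q) \<in> K" and sol: "riccati_solution T B C (A, \<Gamma>, R, Q) P"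
      and t: "t \<in> {0..T}"
    have "norm (P t ** transpose C ** matrix_inv Q) \<le> norm (P t) * norm C * norm (matrix_inv Q)"
      using norm_sandwich_le[of "P t" "transpose C"] by (simp add: norm_transpose)
    also have "\<dots> \<le> \<beta> * norm C * M"
      using cb[OF S] rb[OF S sol t] \<beta>0 M0 by (intro mult_mono) auto
    finally show "norm A \<le> M + \<beta> * norm C * M \<and>
        norm (P t ** transpose C ** matrix_inv Q) \<le> M + \<beta> * norm C * M"
      using cb[OF S] M0 mult_nonneg_nonneg[OF mult_nonneg_nonneg[OF less_imp_le[OF \<beta>0] norm_ge_zero] less_imp_le[OF M0], of C]
      by linarith
  next
    fix A1 \<Gamma>1 R1 Q1 P1 A2 \<Gamma>2 R2 Q2 P2 t
    assume S1: "(A1, \<Gamma>1, R1, Q1) \<in> K" and sol1: "riccati_solution T B C (A1, \<Gamma>1, R1, Q1) P1"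
      and S2: "(A2, \<Gamma>2, R2, Q2) \<in> K" and sol2: "riccati_solution T B C (A2, \<Gamma>2, R2, Q2) P2"
      and t: "t \<in> {0..T}"
    let ?d = "sysdist (A1, \<Gamma>1, R1, Q1) (A2, \<Gamma>2, R2, Q2)"
    have d0: "0 \<le> ?d" by (rule sysdist_nonneg)
    have Qd: "norm (Q1 - Q2) \<le> ?d" by simp
    have 1: "norm (P1 t ** transpose C - P2 t ** transpose C) \<le> l * ?d * norm C"
      using norm_matrix_mult_diff_le[of "P1 t" "transpose C" "P2 t" "transpose C"]
        mult_right_mono[OF lip[OF S1 S2 sol1 sol2 t], of "norm C"]
      by (simp add: norm_transpose)
    have 2: "norm (P2 t ** transpose C) \<le> \<beta> * norm C"
      using norm_matrix_mult_le[of "P2 t" "transpose C"] rb[OF S2 sol2 t]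
        mult_right_mono[of "norm (P2 t)" \<beta> "norm C"]
      by (simp add: norm_transpose)
    have "norm (matrix_inv Q1 - matrix_inv Q2)
        \<le> norm (matrix_inv Q1) * norm (Q1 - Q2) * norm (matrix_inv Q2)"
      by (intro norm_matrix_inv_diff_le spd_invertible) (use cb[OF S1] cb[OF S2] in blast)+
    also have "\<dots> \<le> M * ?d * M"
      using cb[OF S1] cb[OF S2] M0 Qd d0
      by (intro mult_mono mult_nonneg_nonneg) (auto simp del: norm1.simps)
    finally have 3: "norm (matrix_inv Q1 - matrix_inv Q2) \<le> M * ?d * M" .
    have 4: "norm (matrix_inv Q1) \<le> M" using cb[OF S1] by blast
    have "norm (P1 t ** transpose C ** matrix_inv Q1 - P2 t ** transpose C ** matrix_inv Q2)
        \<le> norm (P1 t ** transpose C - P2 t ** transpose C) * norm (matrix_inv Q1)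
          + norm (P2 t ** transpose C) * norm (matrix_inv Q1 - matrix_inv Q2)"
      by (rule norm_matrix_mult_diff_le)
    also have "\<dots> \<le> (l * ?d * norm C) * M + (\<beta> * norm C) * (M * ?d * M)"
      using l0 d0 \<beta>0 by (intro add_mono mult_mono 1 2 3 4) (simp_all del: norm1.simps)
    also have "\<dots> = (l * norm C * M + \<beta> * norm C * (M * M)) * ?d"
      by (simp add: algebra_simps del: norm1.simps)
    finally show "norm (P1 t ** transpose C ** matrix_inv Q1 - P2 t ** transpose C ** matrix_inv Q2)
        \<le> (l * norm C * M + \<beta> * norm C * (M * M)) * ?d" .
  qed
qed

lemma observer_class_lipschitz:
  assumes y: "L2_on T y"
  obtains l where "0 \<le> l"
    "\<And>S1 S2 P1 P2 x1 x2 t. S1 \<in> K \<Longrightarrow> S2 \<in> K \<Longrightarrow>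
      riccati_solution T B C S1 P1 \<Longrightarrow> riccati_solution T B C S2 P2 \<Longrightarrow>
      observer_solution T C y x0 S1 P1 x1 \<Longrightarrow> observer_solution T C y x0 S2 P2 x2 \<Longrightarrow>
      t \<in> {0..T} \<Longrightarrow> norm (x1 t - x2 t) \<le> l * sysdist S1 S2"
proof -
  obtain b l where b0: "0 \<le> b" and l0: "0 \<le> l"
    and gb: "\<And>A1 \<Gamma>1 R1 Q1 P1 t. (A1, \<Gamma>1, R1, Q1) \<in> K \<Longrightarrow>
      riccati_solution T B C (A1, \<Gamma>1, R1, Q1) P1 \<Longrightarrow> t \<in> {0..T} \<Longrightarrow>
      norm A1 \<le> b \<and> norm (P1 t ** transpose C ** matrix_inv Q1) \<le> b"
    and gl: "\<And>A1 \<Gamma>1 R1 Q1 P1 A2 \<Gamma>2 R2 Q2 P2 t.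
      (A1, \<Gamma>1, R1, Q1) \<in> K \<Longrightarrow> riccati_solution T B C (A1, \<Gamma>1, R1, Q1) P1 \<Longrightarrow>
      (A2, \<Gamma>2, R2, Q2) \<in> K \<Longrightarrow> riccati_solution T B C (A2, \<Gamma>2, R2, Q2) P2 \<Longrightarrow> t \<in> {0..T} \<Longrightarrow>
      norm (P1 t ** transpose C ** matrix_inv Q1 - P2 t ** transpose C ** matrix_inv Q2)
        \<le> l * sysdist (A1, \<Gamma>1, R1, Q1) (A2, \<Gamma>2, R2, Q2)"
    by (rule gain_class_estimates) blast
  define M where "M = b + norm C + 1"
  have M0: "0 < M" and CM: "norm C \<le> M" and bM: "b \<le> M"
    using b0 norm_ge_zero[of C] unfolding M_def by linarith+
  have "set_integrable lebesgue {0..T} (\<lambda>s. norm (y s))"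
    using L2_on_set_integrable[OF y] by (rule set_integrable_norm)
  then have yi: "(\<lambda>s. norm (y s)) integrable_on {0..T}"
    by (rule set_lebesgue_integral_eq_integral(1))
  define Y where "Y = integral {0..T} (\<lambda>s. norm (y s))"
  have Y0: "0 \<le> Y" unfolding Y_def using yi by (rule integral_nonneg) simp
  define X where "X = (norm x0 + M * Y) * exp (2 * (M + M * M) * T)"
  have X0: "0 \<le> X" unfolding X_def using M0 Y0 by simp
  define c where "c = (T * (X + M * X) + Y) * exp (2 * (M + M * M) * T)"
  have c0: "0 \<le> c" unfolding c_def using T X0 Y0 M0 by simp
  show ?thesis
  proof (rule that)
    show "0 \<le> c * (l + 1)" using c0 l0 by simp
    fix S1 S2 P1 P2 x1 x2 t
    assume S: "S1 \<in> K" "S2 \<in> K" and t: "t \<in> {0..T}"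
      and sol: "riccati_solution T B C S1 P1" "riccati_solution T B C S2 P2"
      and obs: "observer_solution T C y x0 S1 P1 x1" "observer_solution T C y x0 S2 P2 x2"
    obtain A1 \<Gamma>1 R1 Q1 where S1: "S1 = (A1, \<Gamma>1, R1, Q1)" by (cases S1 rule: prod_cases4)
    obtain A2 \<Gamma>2 R2 Q2 where S2: "S2 = (A2, \<Gamma>2, R2, Q2)" by (cases S2 rule: prod_cases4)
    let ?H1 = "\<lambda>s. P1 s ** transpose C ** matrix_inv Q1"
    let ?H2 = "\<lambda>s. P2 s ** transpose C ** matrix_inv Q2"
    obtain g1 N1 where ode1: "observer_ode T C y A1 ?H1 x1 g1 N1" and i1: "x1 0 = x0"
      using observer_solution_imp_ode[OF obs(1)[unfolded S1]] by blast
    obtain g2 N2 where ode2: "observer_ode T C y A2 ?H2 x2 g2 N2" and i2: "x2 0 = x0"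
      using observer_solution_imp_ode[OF obs(2)[unfolded S2]] by blast
    note gb1 = gb[OF S(1)[unfolded S1] sol(1)[unfolded S1]]
    note gb2 = gb[OF S(2)[unfolded S2] sol(2)[unfolded S2]]
    have b1: "norm A1 \<le> M" "\<And>s. s \<in> {0..T} \<Longrightarrow> norm (?H1 s) \<le> M"
      by (rule order_trans[OF conjunct1[OF gb1[OF t]] bM])
        (rule order_trans[OF conjunct2[OF gb1] bM])
    have b2: "norm A2 \<le> M" "\<And>s. s \<in> {0..T} \<Longrightarrow> norm (?H2 s) \<le> M"
      by (rule order_trans[OF conjunct1[OF gb2[OF t]] bM])
        (rule order_trans[OF conjunct2[OF gb2] bM])
    have X: "norm (x2 s) \<le> X" if "s \<in> {0..T}" for s
      using observer_bound[OF T M0 CM yi ode2 b2 that] by (simp add: X_def Y_def i2)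
    let ?\<delta> = "(l + 1) * sysdist S1 S2"
    have le: "sysdist S1 S2 \<le> ?\<delta>" "l * sysdist S1 S2 \<le> ?\<delta>"
      using sysdist_nonneg[of S1 S2] l0 by (simp_all add: distrib_right)
    have dA: "norm (A1 - A2) \<le> ?\<delta>"
      by (rule order_trans[OF _ le(1)]) (simp add: S1 S2)
    have dH: "norm (?H1 s - ?H2 s) \<le> ?\<delta>" if "s \<in> {0..T}" for s
      using gl[OF S(1)[unfolded S1] sol(1)[unfolded S1] S(2)[unfolded S2] sol(2)[unfolded S2] that]
      by (intro order_trans[OF _ le(2)]) (simp only: S1 S2)
    have "norm (x1 t - x2 t) \<le> c * ?\<delta>"
      unfolding c_def Y_def
      using observer_lipschitz[OF T M0 CM yi ode1 ode2 _ b1 dA dH X t] by (simp add: i1 i2)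
    then show "norm (x1 t - x2 t) \<le> c * (l + 1) * sysdist S1 S2" by (simp only: mult.assoc)
  qed
qed

end

lemma sysdist_le_norm1:
  fixes \<nu>n :: "real^'n^'n \<Rightarrow> real" and \<nu>m :: "real^'m^'m \<Rightarrow> real" and \<nu>r :: "real^'r^'r \<Rightarrow> real"
  assumes "is_norm \<nu>n" "is_norm \<nu>m" "is_norm \<nu>r"
  obtains c where "0 < c"
    "\<And>S1 S2 :: ('n::finite, 'm::finite, 'r::finite) system. sysdist S1 S2 \<le> c * norm1 \<nu>n \<nu>m \<nu>r (S1 - S2)"
proof -
  obtain a where a: "a > 0" "\<And>v. norm v \<le> a * \<nu>n v" using is_norm_dominates[OF assms(1)] by metis
  obtain b where b: "b > 0" "\<And>v. norm v \<le> b * \<nu>m v" using is_norm_dominates[OF assms(2)] by metis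
  obtain d where d: "d > 0" "\<And>v. norm v \<le> d * \<nu>r v" using is_norm_dominates[OF assms(3)] by metis
  have nn: "0 \<le> \<nu>n u" "0 \<le> \<nu>m v" "0 \<le> \<nu>r w" for u v w
    using order_trans[OF norm_ge_zero a(2)] order_trans[OF norm_ge_zero b(2)]
      order_trans[OF norm_ge_zero d(2)] a(1) b(1) d(1) by (auto simp: zero_le_mult_iff)
  have le: "norm u \<le> (a + b + d) * \<nu>n u" "norm v \<le> (a + b + d) * \<nu>m v" "norm w \<le> (a + b + d) * \<nu>r w"
    for u v w
    using a(1) b(1) d(1) nn
    by (intro order_trans[OF a(2)] order_trans[OF b(2)] order_trans[OF d(2)] mult_right_mono; simp)+
  show ?thesis
  proof (rule that)
    show "0 < a + b + d" using a b d by simp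
    fix S1 S2 :: "('n, 'm, 'r) system"
    have "norm1 norm norm norm S \<le> (a + b + d) * norm1 \<nu>n \<nu>m \<nu>r S" for S :: "('n, 'm, 'r) system"
    proof (cases S rule: prod_cases4)
      case (fields A \<Gamma> R Q)
      then show ?thesis
        using le(1)[of A] le(1)[of \<Gamma>] le(2)[of R] le(3)[of Q]
        by (simp only: norm1.simps distrib_left)
    qed
    then show "sysdist S1 S2 \<le> (a + b + d) * norm1 \<nu>n \<nu>m \<nu>r (S1 - S2)" .
  qed
qed

lemma value_fun_quadratic:
  obtains r where "\<And>x. value_fun C y S P xh t x = wnorm_sq (matrix_inv (P t)) (x - xh t) + r"
  by (cases S rule: prod_cases4) simp

section \<open>Robustness of the estimators\<close>

text \<open>The comparison with \<open>p\<close> produces some index \<open>k\<close> that cannot be controlled, so all centres are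
  assumed near \<open>p\<close> and all weights comparable.\<close>

lemma estimates_close:
  fixes P :: "'k \<Rightarrow> real^'n^'n" and c :: "'k \<Rightarrow> real^'n" and r :: "'k \<Rightarrow> real"
  assumes fin: "finite \<Sigma>" and ne: "\<Sigma> \<noteq> {}" and \<theta>: "\<theta> > 0"
    and V: "\<And>k x. k \<in> \<Sigma> \<Longrightarrow> V k t x = wnorm_sq (P k) (x - c k) + r k"
    and sym: "\<And>k. k \<in> \<Sigma> \<Longrightarrow> transpose (P k) = P k"
    and l: "0 < l" and lo: "\<And>k x. k \<in> \<Sigma> \<Longrightarrow> l * (norm x)\<^sup>2 \<le> x \<bullet> (P k *v x)"
    and up: "\<And>k. k \<in> \<Sigma> \<Longrightarrow> norm (P k) \<le> b"
    and near: "\<And>k. k \<in> \<Sigma> \<Longrightarrow> norm (c k - p) \<le> d"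
  shows "norm (estimate_max \<Sigma> V t - p) \<le> 2 * b / l * d"
    and "norm (estimate_exp \<theta> \<Sigma> V t - p) \<le> 2 * b / l * d"
proof -
  have V': "V k t = (\<lambda>x. wnorm_sq (P k) (x - c k) + r k)" if "k \<in> \<Sigma>" for k
    using V[OF that] by (rule ext)
  have cont: "continuous_on UNIV (V k t)" if "k \<in> \<Sigma>" for k
    unfolding V'[OF that] wnorm_sq_def
    by (intro continuous_intros continuous_on_matrix_vector_mult)
  have bdd: "bounded {x. V k t x \<le> B}" if "k \<in> \<Sigma>" for k B
    unfolding V'[OF that] by (rule bounded_quadratic_sublevel[OF l lo[OF that]])
  have close: "norm (z - p) \<le> 2 * b / l * d" if ex: "\<exists>k\<in>\<Sigma>. V k t z \<le> V k t p" for z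
  proof -
    obtain k where k: "k \<in> \<Sigma>" "V k t z \<le> V k t p" using ex by blast
    have b0: "0 \<le> b" using up[OF k(1)] norm_ge_zero order_trans by blast
    have "norm (z - p) \<le> 2 * b / l * norm (c k - p)"
      using k(2) unfolding V[OF k(1)]
      by (rule distance_from_value_comparison[OF sym[OF k(1)] l lo[OF k(1)] up[OF k(1)]])
    also have "\<dots> \<le> 2 * b / l * d"
      using b0 l by (intro mult_left_mono near k(1)) simp
    finally show ?thesis .
  qed
  show "norm (estimate_max \<Sigma> V t - p) \<le> 2 * b / l * d"
    by (rule close[OF estimate_max_le_some_value[where V = V and t = t, OF fin ne cont bdd]])
  show "norm (estimate_exp \<theta> \<Sigma> V t - p) \<le> 2 * b / l * d"
    by (rule close[OF estimate_exp_le_some_value[where V = V and t = t, OF fin ne cont bdd \<theta>]])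
qed

theorem proposition5p3:
  fixes T :: real
    and B :: "real^'m^'n" and C :: "real^'n^'r"
    and x0 :: "real^'n" and y :: "real \<Rightarrow> real^'r"
    and \<nu>n :: "real^'n^'n \<Rightarrow> real" and \<nu>m :: "real^'m^'m \<Rightarrow> real" and \<nu>r :: "real^'r^'r \<Rightarrow> real"
    and K :: "('n::finite, 'm::finite, 'r::finite) system set"
  assumes "T > 0"
    and "L2_on T y"
    and "is_norm \<nu>n" and "is_norm \<nu>m" and "is_norm \<nu>r"
    and "compact K" and "\<forall>S\<in>K. admissible S"
  shows "\<exists>c>0.
    \<forall>(\<Sigma>A :: 'a set) (\<Sigma>\<Gamma> :: 'b set) (\<Sigma>R :: 'c set) (\<Sigma>Q :: 'd set) A \<Gamma> R Q \<Pi>f xh \<sigma>bar.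
      let \<Sigma> = \<Sigma>A \<times> \<Sigma>\<Gamma> \<times> \<Sigma>R \<times> \<Sigma>Q;
          S = system_of A \<Gamma> R Q;
          V = (\<lambda>\<sigma>. value_fun C y (S \<sigma>) (\<Pi>f \<sigma>) (xh \<sigma>));
          Pbar = (\<lambda>t. matrix_inv (\<Pi>f \<sigma>bar t));
          \<delta> = Max ((\<lambda>\<sigma>. norm1 \<nu>n \<nu>m \<nu>r (S \<sigma> - S \<sigma>bar)) ` \<Sigma>)
      in finite \<Sigma>A \<and> finite \<Sigma>\<Gamma> \<and> finite \<Sigma>R \<and> finite \<Sigma>Q \<and>
         (\<forall>\<sigma>\<in>\<Sigma>. S \<sigma> \<in> K \<and>
            riccati_solution T B C (S \<sigma>) (\<Pi>f \<sigma>) \<and>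
            observer_solution T C y x0 (S \<sigma>) (\<Pi>f \<sigma>) (xh \<sigma>)) \<and>
         \<sigma>bar \<in> \<Sigma>
         \<longrightarrow> (\<forall>t\<in>{0..T}. \<forall>\<theta>>0.
               wnorm (Pbar t) (estimate_max \<Sigma> V t - xh \<sigma>bar t) \<le> c * \<delta> \<and>
               wnorm (Pbar t) (estimate_exp \<theta> \<Sigma> V t - xh \<sigma>bar t) \<le> c * \<delta>)"
proof -
  have T: "0 \<le> T" using assms(1) by simp
  obtain \<alpha> \<beta> where \<alpha>: "0 < \<alpha>" and \<beta>: "0 < \<beta>"
    and rb: "\<And>S P t. S \<in> K \<Longrightarrow> riccati_solution T B C S P \<Longrightarrow> t \<in> {0..T} \<Longrightarrow>
      transpose (P t) = P t \<and> norm (P t) \<le> \<beta> \<and> (\<forall>x. \<alpha> * (norm x)\<^sup>2 \<le> x \<bullet> (P t *v x))"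
    by (rule riccati_class_bounds[OF T assms(6,7)]) blast
  obtain \<kappa> where \<kappa>: "0 \<le> \<kappa>" and lip: "\<And>S1 S2 P1 P2 x1 x2 t. S1 \<in> K \<Longrightarrow> S2 \<in> K \<Longrightarrow>
      riccati_solution T B C S1 P1 \<Longrightarrow> riccati_solution T B C S2 P2 \<Longrightarrow>
      observer_solution T C y x0 S1 P1 x1 \<Longrightarrow> observer_solution T C y x0 S2 P2 x2 \<Longrightarrow>
      t \<in> {0..T} \<Longrightarrow> norm (x1 t - x2 t) \<le> \<kappa> * sysdist S1 S2"
    by (rule observer_class_lipschitz[OF T assms(6,7) assms(2)]) blast
  obtain \<gamma> where \<gamma>: "0 < \<gamma>" and dist: "\<And>S1 S2 :: ('n, 'm, 'r) system.
      sysdist S1 S2 \<le> \<gamma> * norm1 \<nu>n \<nu>m \<nu>r (S1 - S2)"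
    by (rule sysdist_le_norm1[OF assms(3-5)]) blast
  \<comment> \<open>Bounds \<open>l |x|\<^sup>2 \<le> x \<bullet> P x\<close> and \<open>|P| \<le> b\<close> for the inverses \<open>P\<close> of the Riccati solutions.\<close>
  define l where "l = \<alpha> / \<beta>\<^sup>2"
  define b where "b = real CARD('n) * real CARD('n) / \<alpha>"
  \<comment> \<open>The factor \<open>1 / sqrt \<alpha>\<close> passes from the Euclidean to the weighted norm; \<open>c\<close> may vanish, so
    \<open>c + 1\<close> serves as the positive constant.\<close>
  define c where "c = 2 * b / l * (\<kappa> * \<gamma>) / sqrt \<alpha>"
  have l: "0 < l" using \<alpha> \<beta> by (simp add: l_def)
  have c0: "0 \<le> c" using \<alpha> l \<kappa> \<gamma> by (simp add: c_def b_def)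
  have main: "wnorm (matrix_inv (\<Pi>f \<sigma>bar t)) (estimate_max \<Sigma> V t - xh \<sigma>bar t) \<le> (c + 1) * \<delta> \<and>
      wnorm (matrix_inv (\<Pi>f \<sigma>bar t)) (estimate_exp \<theta> \<Sigma> V t - xh \<sigma>bar t) \<le> (c + 1) * \<delta>"
    if fin: "finite \<Sigma>" and bar: "\<sigma>bar \<in> \<Sigma>"
      and V: "V = (\<lambda>\<sigma>. value_fun C y (S \<sigma>) (\<Pi>f \<sigma>) (xh \<sigma>))"
      and \<delta>: "\<delta> = Max ((\<lambda>\<sigma>. norm1 \<nu>n \<nu>m \<nu>r (S \<sigma> - S \<sigma>bar)) ` \<Sigma>)"
      and sol: "\<forall>\<sigma>\<in>\<Sigma>. S \<sigma> \<in> K \<and> riccati_solution T B C (S \<sigma>) (\<Pi>f \<sigma>) \<and>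
            observer_solution T C y x0 (S \<sigma>) (\<Pi>f \<sigma>) (xh \<sigma>)"
      and t: "t \<in> {0..T}" and \<theta>: "\<theta> > 0"
    for \<Sigma> :: "('a \<times> 'b \<times> 'c \<times> 'd) set" and S \<Pi>f xh \<sigma>bar V t \<theta> \<delta>
  proof -
    let ?P = "\<lambda>\<sigma>. matrix_inv (\<Pi>f \<sigma> t)"
    have sK: "S \<sigma> \<in> K" and sR: "riccati_solution T B C (S \<sigma>) (\<Pi>f \<sigma>)"
      and sO: "observer_solution T C y x0 (S \<sigma>) (\<Pi>f \<sigma>) (xh \<sigma>)" if "\<sigma> \<in> \<Sigma>" for \<sigma>
      using sol that by blast+
    have sym: "transpose (\<Pi>f \<sigma> t) = \<Pi>f \<sigma> t" and up: "norm (\<Pi>f \<sigma> t) \<le> \<beta>"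
      and lo: "\<alpha> * (norm x)\<^sup>2 \<le> x \<bullet> (\<Pi>f \<sigma> t *v x)" if "\<sigma> \<in> \<Sigma>" for \<sigma> x
      using rb[OF sK sR t, OF that that] by blast+
    have \<delta>ge: "norm1 \<nu>n \<nu>m \<nu>r (S \<sigma> - S \<sigma>bar) \<le> \<delta>" if "\<sigma> \<in> \<Sigma>" for \<sigma>
      unfolding \<delta> using fin that by (intro Max_ge) simp_all
    have \<delta>0: "0 \<le> \<delta>"
      using order_trans[OF sysdist_nonneg dist[of "S \<sigma>bar" "S \<sigma>bar"]] \<delta>ge[OF bar] \<gamma>
      by (simp add: zero_le_mult_iff)
    have near: "norm (xh \<sigma> t - xh \<sigma>bar t) \<le> \<kappa> * (\<gamma> * \<delta>)" if s: "\<sigma> \<in> \<Sigma>" for \<sigma>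
    proof -
      have "norm (xh \<sigma> t - xh \<sigma>bar t) \<le> \<kappa> * sysdist (S \<sigma>) (S \<sigma>bar)"
        by (rule lip[OF sK[OF s] sK[OF bar] sR[OF s] sR[OF bar] sO[OF s] sO[OF bar] t])
      also have "\<dots> \<le> \<kappa> * (\<gamma> * \<delta>)"
        using \<kappa> \<gamma> \<delta>ge[OF s] by (intro mult_left_mono order_trans[OF dist]) simp_all
      finally show ?thesis .
    qed
    have "\<forall>\<sigma>. \<exists>r. \<forall>x. V \<sigma> t x = wnorm_sq (?P \<sigma>) (x - xh \<sigma> t) + r"
      unfolding V by (metis value_fun_quadratic)
    then obtain r where r: "\<And>\<sigma> x. V \<sigma> t x = wnorm_sq (?P \<sigma>) (x - xh \<sigma> t) + r \<sigma>"
      by metis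
    have Psym: "transpose (?P \<sigma>) = ?P \<sigma>" if s: "\<sigma> \<in> \<Sigma>" for \<sigma>
      by (rule transpose_matrix_inv[OF invertible_of_form_bound[OF sym[OF s] \<alpha> lo[OF s]] sym[OF s]])
    have Plo: "l * (norm x)\<^sup>2 \<le> x \<bullet> (?P \<sigma> *v x)" if s: "\<sigma> \<in> \<Sigma>" for \<sigma> x
      unfolding l_def by (rule matrix_inv_form_ge[OF sym[OF s] \<alpha> lo[OF s] up[OF s] \<beta>])
    have Pup: "norm (?P \<sigma>) \<le> b" if s: "\<sigma> \<in> \<Sigma>" for \<sigma>
      unfolding b_def by (rule norm_matrix_inv_le[OF sym[OF s] \<alpha> lo[OF s]])
    have ne: "\<Sigma> \<noteq> {}" using bar by blast
    have weight: "wnorm (?P \<sigma>bar) u \<le> (c + 1) * \<delta>"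
      if u: "norm u \<le> 2 * b / l * (\<kappa> * (\<gamma> * \<delta>))" for u
    proof -
      have "wnorm (?P \<sigma>bar) u \<le> sqrt ((norm u)\<^sup>2 / \<alpha>)"
        unfolding wnorm_def wnorm_sq_def
        by (intro real_sqrt_le_mono matrix_inv_form_le[OF sym[OF bar] \<alpha> lo[OF bar]])
      also have "\<dots> = norm u / sqrt \<alpha>" by (simp add: real_sqrt_divide)
      also have "\<dots> \<le> 2 * b / l * (\<kappa> * (\<gamma> * \<delta>)) / sqrt \<alpha>"
        using u \<alpha> by (intro divide_right_mono) simp_all
      also have "\<dots> = c * \<delta>" by (simp add: c_def)
      also have "\<dots> \<le> (c + 1) * \<delta>" using \<delta>0 by (simp add: distrib_right)
      finally show ?thesis .
    qed
    note close = estimates_close[where V = V and t = t and P = ?P and c = "\<lambda>\<sigma>. xh \<sigma> t",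
        OF fin ne \<theta> r Psym l Plo Pup near]
    show ?thesis
      by (intro conjI weight close)
  qed
  show ?thesis
    apply (intro exI[of _ "c + 1"] conjI allI)
    subgoal using c0 by simp
    subgoal for \<Sigma>A \<Sigma>\<Gamma> \<Sigma>R \<Sigma>Q A \<Gamma> R Q \<Pi>f xh \<sigma>bar
      unfolding Let_def
      apply (intro impI ballI allI, elim conjE, rule main[OF _ _ refl refl])
          apply (intro finite_cartesian_product; assumption)
         apply assumption+
      done
    done
qed

end
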